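(* Let $U'' \subset U' \subset U \subset \mathbb{C}$ be path connected open sets such that $\bar U$ is compact and simply connected, and let $\Gamma \subset U''$ be a piecewise smooth curve. Let $f:\bar U\to\mathbb{C}$ be a holomorphic function with no zeros on $\Gamma$. Let $D,\varepsilon>0$ be real numbers with $\frac{D}{\varepsilon}>3$ such that (gap condition) $\rho(\Gamma,\partial U'')\ge\varepsilon$, $\rho(U'',\partial U')\ge\varepsilon$, $\rho(U',\partial U)\ge\varepsilon$; (diameter condition) $\operatorname{diam}_{int}U''\le D$, $\operatorname{diam}_{int}U'\le D$. Then $$V_\Gamma(f)\le B_{U'',U}(f)\left(\frac{|\Gamma|}{\varepsilon}+\kappa(\Gamma)+1\right)e^{\frac{5D}{\varepsilon}}.$$
   Context: Here $\rho$ is the Euclidean distance in $\mathbb{C}$ (between sets: the infimum of distances between their points). Intrinsic diameter: the intrinsic distance between two points of a path connected set $K$ in a metric space is the infimum of the lengths of paths in $K$ connecting these points (if it exists); $\operatorname{diam}_{int}K$ is the supremum of the intrinsic distances between pairs of points of $K$. Bernstein index: $B_{K,U}(f)=\log\frac{M}{m}$ with $M=\sup_U|f|$ and $m=\max_K|f|$; when $K$ is replaced by an open set such as $U''$, $m=\sup_{U''}|f|=\max_{\bar U''}|f|$. Variation of argument: for a curve $\Gamma:[0,1]\to U$ and a function $f$ with $f|_\Gamma\neq0$, choose a continuous branch of $\arg f$ along $\Gamma$ and let $\phi=\arg f\circ\Gamma$; $V_\Gamma(f)$ is the total variation of $\phi$ on $[0,1]$. $|\Gamma|$ is the length of $\Gamma$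 and $\kappa(\Gamma)$ is its total (absolute) curvature, i.e. the integral of the absolute value of the curvature with respect to arc length over the smooth pieces plus the contribution (absolute values of the turning angles) of the vertices. *)

theory Defs
  imports "HOL-Analysis.Analysis"
begin

text \<open>Total variation on \<open>[0,1]\<close> as a supremum over finite partitions.  For a path this is its
  length; for a real function it is the usual total variation.\<close>

definition total_variation :: "(real \<Rightarrow> 'a::metric_space) \<Rightarrow> ereal" where
  "total_variation g =
     (SUP (n, t) \<in> {(n::nat, t::nat \<Rightarrow> real). mono t \<and> range t \<subseteq> {0..1}}.
        ereal (\<Sum>i<n. dist (g (t i)) (g (t (Suc i)))))"

abbreviation curve_length :: "(real \<Rightarrow> 'a::metric_space) \<Rightarrow> ereal" where
  "curve_length \<equiv> total_variation"

text \<open>The infimum of the empty set and of infinite lengths is \<open>\<infinity>\<close>, so a finite bound on the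
  intrinsic diameter includes the existence of connecting paths of finite length.\<close>

definition intrinsic_dist :: "'a::metric_space set \<Rightarrow> 'a \<Rightarrow> 'a \<Rightarrow> ereal" where
  "intrinsic_dist K x y =
     (INF g \<in> {g. path g \<and> path_image g \<subseteq> K \<and> pathstart g = x \<and> pathfinish g = y}.
        curve_length g)"

definition intrinsic_diam :: "'a::metric_space set \<Rightarrow> ereal" where
  "intrinsic_diam K = (SUP x\<in>K. SUP y\<in>K. intrinsic_dist K x y)"

text \<open>The lower supremum is a maximum if \<open>K\<close> is compact and nonempty and \<open>f\<close> is continuous; if
  \<open>K\<close> is open and bounded and \<open>f\<close> is continuous on \<open>closure K\<close>, it is the maximum over
  \<open>closure K\<close>.\<close>

definition bernstein_index :: "complex set \<Rightarrow> complex set \<Rightarrow> (complex \<Rightarrow> complex) \<Rightarrow> real" where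
  "bernstein_index K U f = ln ((SUP z\<in>U. norm (f z)) / (SUP z\<in>K. norm (f z)))"

definition is_arg_branch ::
    "(complex \<Rightarrow> complex) \<Rightarrow> (real \<Rightarrow> complex) \<Rightarrow> (real \<Rightarrow> real) \<Rightarrow> bool" where
  "is_arg_branch f \<gamma> \<phi> \<longleftrightarrow>
     continuous_on {0..1} \<phi> \<and>
     (\<forall>t\<in>{0..1}. f (\<gamma> t) = of_real (norm (f (\<gamma> t))) * cis (\<phi> t))"

text \<open>The value does not depend on the chosen branch, and a branch exists whenever \<open>f \<circ> \<gamma>\<close> is
  continuous without zeros: see \<open>arg_variation_eq\<close> and \<open>arg_branch_exists\<close> below.\<close>

definition arg_variation :: "(complex \<Rightarrow> complex) \<Rightarrow> (real \<Rightarrow> complex) \<Rightarrow> ereal" where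
  "arg_variation f \<gamma> = total_variation (SOME \<phi>. is_arg_branch f \<gamma> \<phi>)"

text \<open>A smooth piece is of class \<open>C\<^sup>2\<close> up to its endpoints, with nowhere vanishing velocity, so that
  its curvature is defined.\<close>

definition smooth_piece :: "(real \<Rightarrow> complex) \<Rightarrow> real \<Rightarrow> real \<Rightarrow> bool" where
  "smooth_piece \<gamma> a b \<longleftrightarrow>
     (\<exists>\<gamma>' \<gamma>''. continuous_on {a..b} \<gamma>'' \<and>
        (\<forall>t\<in>{a..b}. (\<gamma> has_vector_derivative \<gamma>' t) (at t within {a..b}) \<and>
                    (\<gamma>' has_vector_derivative \<gamma>'' t) (at t within {a..b}) \<and>
                    \<gamma>' t \<noteq> 0))"

definition piecewise_smooth :: "(real \<Rightarrow> complex) \<Rightarrow> bool" where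
  "piecewise_smooth \<gamma> \<longleftrightarrow>
     path \<gamma> \<and>
     (\<exists>(n::nat) (t::nat \<Rightarrow> real). t 0 = 0 \<and> t n = 1 \<and>
        (\<forall>i<n. t i < t (Suc i) \<and> smooth_piece \<gamma> (t i) (t (Suc i))))"

definition velocity :: "(real \<Rightarrow> complex) \<Rightarrow> real \<Rightarrow> complex" where
  "velocity \<gamma> t = vector_derivative \<gamma> (at t)"

text \<open>Absolute value of the curvature: for \<open>\<gamma> = x + i y\<close> the numerator is
  \<open>\<bar>x' y'' - y' x''\<bar>\<close>.\<close>

definition abs_curvature :: "(real \<Rightarrow> complex) \<Rightarrow> real \<Rightarrow> real" where
  "abs_curvature \<gamma> t =
     \<bar>Im (cnj (velocity \<gamma> t) * vector_derivative (velocity \<gamma>) (at t))\<bar> / norm (velocity \<gamma> t) ^ 3"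

text \<open>Angle in \<open>[0,\<pi>]\<close> between the incoming and the outgoing one-sided velocities.\<close>

definition turning_angle :: "(real \<Rightarrow> complex) \<Rightarrow> real \<Rightarrow> real" where
  "turning_angle \<gamma> t =
     \<bar>Arg (vector_derivative \<gamma> (at_right t) / vector_derivative \<gamma> (at_left t))\<bar>"

text \<open>For a piecewise smooth curve the two-sided derivatives exist outside a finite set, which does
  not affect the integral, and the turning angle vanishes at all smooth parameters, so the sum is
  the finite sum over the vertices.  A curve is a map on \<open>[0,1]\<close>: for a closed one, no turning
  angle is added at the common endpoint.\<close>

definition total_curvature :: "(real \<Rightarrow> complex) \<Rightarrow> real" where
  "total_curvature \<gamma> =
     integral {0..1} (\<lambda>t. abs_curvature \<gamma> t * norm (velocity \<gamma> t)) +
     (\<Sum>t | t \<in> {0<..<1} \<and> turning_angle \<gamma> t \<noteq> 0. turning_angle \<gamma> t)"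

lemma arg_branch_exists:
  assumes "path \<gamma>" "continuous_on (path_image \<gamma>) f" "\<forall>z\<in>path_image \<gamma>. f z \<noteq> 0"
  shows "\<exists>\<phi>. is_arg_branch f \<gamma> \<phi>"
proof -
  have c: "continuous_on {0..1} (f \<circ> \<gamma>)"
    using assms(1,2) unfolding path_def path_image_def by (rule continuous_on_compose)
  have nz: "(f \<circ> \<gamma>) t \<noteq> 0" if "t \<in> {0..1}" for t
    using assms(3) that by (auto simp: path_image_def)
  obtain g where g: "continuous_on {0..1} g" "\<And>t. t \<in> {0..1} \<Longrightarrow> (f \<circ> \<gamma>) t = exp (g t)"
    using continuous_logarithm_on_contractible[OF c _ nz] convex_imp_contractible[of "{0..1::real}"]
    by auto
  have "f (\<gamma> t) = of_real (norm (f (\<gamma> t))) * cis (Im (g t))" if "t \<in> {0..1}" for t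
    using g(2)[OF that] by (simp add: exp_eq_polar norm_mult)
  moreover have "continuous_on {0..1} (\<lambda>t. Im (g t))"
    by (intro continuous_intros g(1))
  ultimately show ?thesis
    unfolding is_arg_branch_def by blast
qed

lemma arg_variation_eq:
  assumes nz: "\<forall>z\<in>path_image \<gamma>. f z \<noteq> 0" and b: "is_arg_branch f \<gamma> \<phi>"
  shows "arg_variation f \<gamma> = total_variation \<phi>"
proof -
  define \<psi> where "\<psi> = (SOME \<phi>. is_arg_branch f \<gamma> \<phi>)"
  have b': "is_arg_branch f \<gamma> \<psi>"
    unfolding \<psi>_def using b by (rule someI[of "is_arg_branch f \<gamma>"])
  define h where "h t = (\<psi> t - \<phi> t) / (2 * pi)" for t
  have hint: "h t \<in> \<int>" if t: "t \<in> {0..1}" for t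
  proof -
    have "f (\<gamma> t) \<noteq> 0" using nz t by (auto simp: path_image_def)
    moreover have "of_real (norm (f (\<gamma> t))) * cis (\<psi> t) = of_real (norm (f (\<gamma> t))) * cis (\<phi> t)"
      using b b' t unfolding is_arg_branch_def by metis
    ultimately have "cis (\<psi> t) = cis (\<phi> t)" by simp
    hence "exp (\<i> * of_real (\<psi> t)) = exp (\<i> * of_real (\<phi> t))"
      by (simp add: cis_conv_exp)
    then obtain n :: int where "\<i> * of_real (\<psi> t) = \<i> * of_real (\<phi> t) + (of_int (2 * n) * pi) * \<i>"
      unfolding exp_eq by blast
    hence "\<psi> t = \<phi> t + 2 * of_int n * pi"
      by (auto simp: complex_eq_iff)
    hence "h t = of_int n" by (simp add: h_def)
    thus ?thesis by simp
  qed
  have hc: "continuous_on {0..1} h"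
    using b b' unfolding is_arg_branch_def h_def by (auto intro!: continuous_intros)
  have "h constant_on {0..1}"
  proof (rule continuous_discrete_range_constant[OF _ hc])
    fix x :: real assume x: "x \<in> {0..1}"
    show "\<exists>e>0. \<forall>y. y \<in> {0..1} \<and> h y \<noteq> h x \<longrightarrow> e \<le> norm (h y - h x)"
    proof (intro exI[of _ 1] conjI allI impI; (elim conjE)?)
      fix y assume "y \<in> {0..1}" "h y \<noteq> h x"
      thus "1 \<le> norm (h y - h x)"
        using Ints_nonzero_abs_ge1[OF Ints_diff[OF hint[of y] hint[OF x]]] by simp
    qed simp
  qed simp
  then obtain c where c: "\<And>t. t \<in> {0..1} \<Longrightarrow> h t = c"
    unfolding constant_on_def by blast
  hence eq: "\<psi> t = \<phi> t + 2 * pi * c" if "t \<in> {0..1}" for t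
    using c[OF that] by (simp add: h_def field_simps)
  have "total_variation \<psi> = total_variation \<phi>"
    unfolding total_variation_def
  proof (rule SUP_cong[OF refl])
    fix p :: "nat \<times> (nat \<Rightarrow> real)"
    assume p: "p \<in> {(n, t). mono t \<and> range t \<subseteq> {0..1}}"
    obtain n t where [simp]: "p = (n, t)" by (cases p)
    have "\<psi> (t i) = \<phi> (t i) + 2 * pi * c" for i
      using p by (intro eq) (simp add: image_subset_iff)
    thus "(case p of (n, t) \<Rightarrow> ereal (\<Sum>i<n. dist (\<psi> (t i)) (\<psi> (t (Suc i))))) =
          (case p of (n, t) \<Rightarrow> ereal (\<Sum>i<n. dist (\<phi> (t i)) (\<phi> (t (Suc i)))))"
      by (simp add: dist_real_def)
  qed
  thus ?thesis by (simp add: arg_variation_def \<psi>_def)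
qed

end

theory Submission
  imports Defs "HOL-Complex_Analysis.Complex_Analysis"
begin

text \<open>
  Put \<open>x = D / \<epsilon>\<close>, let \<open>M\<close> be the supremum of \<open>\<bar>f\<bar>\<close> over \<open>U\<close>, and let \<open>b\<close> exceed the Bernstein index, so
  that \<open>\<bar>f p\<bar> \<ge> M e\<^sup>-\<^sup>b\<close> for some \<open>p \<in> U''\<close>.  The theorem combines three facts.

  First, \<open>f\<close> is not too small near any point of \<open>U''\<close>.  Discs of radius \<open>2 \<epsilon>\<close> about points of \<open>U''\<close> lie
  in \<open>U\<close>.  By the three circles theorem, a point within \<open>\<epsilon>/5\<close> of one centre at which
  \<open>\<bar>f\<bar> \<ge> M e\<^sup>-\<^sup>c\<close> yields, for any centre at distance at most \<open>2 \<epsilon>/5\<close> from the first, a point within \<open>\<epsilon>/5\<close>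
  of it at which \<open>\<bar>f\<bar> \<ge> M e\<^sup>-\<^sup>2\<^sup>c\<close>.  A path in \<open>U''\<close> that is hardly longer than \<open>D\<close> is covered by at most
  \<open>5 x / 2 + 2\<close> such steps.  Hence every point of \<open>U''\<close> has a point \<open>q\<close> within \<open>\<epsilon>/5\<close> at which
  \<open>\<bar>f q\<bar> \<ge> M e\<^sup>-\<^sup>\<Lambda>\<close>, where \<open>\<Lambda> = 4 b 2\<^bsup>5x/2\<^esup>\<close> (\<open>uniform_lower_bound_from_one_point\<close>).

  Second, such a lower bound controls \<open>f\<close> in the disc of radius \<open>\<epsilon>/2\<close> about \<open>q\<close>: it contains at most
  \<open>\<Lambda> / ln 2\<close> zeros (\<open>zeros_local_bound\<close>), and once these are divided out, the logarithmic derivative of the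
  rest is at most \<open>80 \<Lambda> / \<epsilon>\<close> within \<open>\<epsilon>/5\<close> of \<open>q\<close> (\<open>zero_free_logderiv_bound\<close>).  So on the curve \<open>f'/f\<close> is a sum of terms
  \<open>1/(z - a)\<close> over zeros \<open>a\<close>, up to an error of size \<open>80 \<Lambda> / \<epsilon>\<close>.

  Third, the argument of \<open>z - a\<close> varies by at most \<open>\<kappa>(\<Gamma>) + \<pi>\<close> along \<open>\<Gamma>\<close>, for every \<open>a\<close> off \<open>\<Gamma>\<close>
  (\<open>rotation_le_total_curvature\<close>): the angle between the position vector and the velocity stays in
  \<open>[0,\<pi>]\<close>, it decreases at the speed of the rotation and increases at most at the speed at which the velocity
  turns.

  If \<open>N\<close> zeros lie near \<open>\<Gamma>\<close>, integration of \<open>\<bar>Im (\<gamma>' f'(\<gamma>)/f(\<gamma>))\<bar>\<close> gives the bound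
  \<open>N (\<kappa>(\<Gamma>) + \<pi>) + 80 \<Lambda> \<bar>\<Gamma>\<bar> / \<epsilon>\<close>.  A grid of mesh \<open>\<epsilon>/5\<close> has at most \<open>(5 x + 2)\<^sup>2\<close> cells that meet a set of
  diameter \<open>D\<close>, and each cell lies in one of the discs above, so \<open>N \<le> (5 x + 2)\<^sup>2 \<Lambda> / ln 2\<close>.  Finally
  \<open>2\<^bsup>5x/2\<^esup> \<le> e\<^sup>2\<^sup>x\<close>, and for \<open>x \<ge> 3\<close> the factor \<open>e\<^sup>3\<^sup>x\<close> absorbs the polynomial and the constants; then \<open>b\<close> tends to the
  Bernstein index.\<close>

section \<open>Total variation and inscribed polygons\<close>

lemma total_variation_le_increment:
  fixes g :: "real \<Rightarrow> 'a::metric_space" and H :: "real \<Rightarrow> real"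
  assumes H: "\<And>s u. 0 \<le> s \<Longrightarrow> s \<le> u \<Longrightarrow> u \<le> 1 \<Longrightarrow> dist (g s) (g u) \<le> H u - H s"
  shows "total_variation g \<le> ereal (H 1 - H 0)"
  unfolding total_variation_def
proof (rule SUP_least, clarify)
  fix n :: nat and t :: "nat \<Rightarrow> real"
  assume t: "mono t" "range t \<subseteq> {0..1}"
  have t01: "0 \<le> t i" "t i \<le> 1" for i using t(2) by (auto simp: image_subset_iff)
  have Hmono: "H s \<le> H u" if "0 \<le> s" "s \<le> u" "u \<le> 1" for s u
    using H[OF that] zero_le_dist[of "g s" "g u"] by linarith
  have "(\<Sum>i<n. dist (g (t i)) (g (t (Suc i)))) \<le> (\<Sum>i<n. H (t (Suc i)) - H (t i))"
    using t01 t(1) by (intro sum_mono H) (auto simp: mono_def)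
  also have "\<dots> = H (t n) - H (t 0)" by (rule sum_lessThan_telescope)
  also have "\<dots> \<le> H 1 - H 0" using Hmono[of "t n" 1] Hmono[of 0 "t 0"] t01 by fastforce
  finally show "ereal (\<Sum>i<n. dist (g (t i)) (g (t (Suc i)))) \<le> ereal (H 1 - H 0)" by simp
qed

text \<open>A predicate rather than the supremum over the partitions of \<open>[0,u]\<close>: lower bounds for lengths are then
  built up along the curve with real numbers only.\<close>

definition polygon_reaches :: "(real \<Rightarrow> 'a::metric_space) \<Rightarrow> real \<Rightarrow> real \<Rightarrow> bool" where
  "polygon_reaches g u x \<longleftrightarrow>
     (\<exists>n (t::nat \<Rightarrow> real). mono t \<and> range t \<subseteq> {0..u} \<and> x \<le> (\<Sum>i<n. dist (g (t i)) (g (t (Suc i)))))"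

lemma polygon_reaches_0: "polygon_reaches g 0 0"
  unfolding polygon_reaches_def by (intro exI[of _ 0] exI[of _ "\<lambda>_. 0"]) (auto simp: mono_def)

text \<open>The new partition passes through \<open>s\<close> before it reaches \<open>u\<close>; the side that ends at \<open>s\<close> can only add to
  the length.\<close>

lemma polygon_reaches_extend:
  assumes "polygon_reaches g s x" "0 \<le> s" "s \<le> u" "y \<le> x + dist (g s) (g u)"
  shows "polygon_reaches g u y"
proof -
  obtain n and t :: "nat \<Rightarrow> real" where t: "mono t" "range t \<subseteq> {0..s}"
      "x \<le> (\<Sum>i<n. dist (g (t i)) (g (t (Suc i))))"
    using assms(1) unfolding polygon_reaches_def by auto
  define t' where "t' i = (if i \<le> n then t i else if i = Suc n then s else u)" for i
  have ts: "0 \<le> t i" "t i \<le> s" for i using t(2) by (auto simp: image_subset_iff)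
  have "mono t'"
    unfolding mono_def t'_def using t(1) ts assms(2,3) by (auto simp: mono_def intro: order_trans[OF ts(2)])
  moreover have "range t' \<subseteq> {0..u}"
    using ts assms(2,3) by (auto simp: t'_def intro: order_trans[OF ts(2)])
  moreover have "y \<le> (\<Sum>i<Suc (Suc n). dist (g (t' i)) (g (t' (Suc i))))"
  proof -
    have "(\<Sum>i<n. dist (g (t' i)) (g (t' (Suc i)))) = (\<Sum>i<n. dist (g (t i)) (g (t (Suc i))))"
      by (intro sum.cong) (auto simp: t'_def)
    hence "(\<Sum>i<Suc (Suc n). dist (g (t' i)) (g (t' (Suc i)))) =
        (\<Sum>i<n. dist (g (t i)) (g (t (Suc i)))) + dist (g (t n)) (g s) + dist (g s) (g u)"
      by (simp add: t'_def)
    thus ?thesis using t(3) assms(4) zero_le_dist[of "g (t n)" "g s"] by linarith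
  qed
  ultimately show ?thesis unfolding polygon_reaches_def by blast
qed

lemma polygon_reaches_le_total_variation:
  assumes "polygon_reaches g 1 x" shows "ereal x \<le> total_variation g"
proof -
  obtain n and t :: "nat \<Rightarrow> real" where t: "mono t" "range t \<subseteq> {0..1}"
      "x \<le> (\<Sum>i<n. dist (g (t i)) (g (t (Suc i))))"
    using assms unfolding polygon_reaches_def by auto
  have "ereal (\<Sum>i<n. dist (g (t i)) (g (t (Suc i)))) \<le> total_variation g"
    unfolding total_variation_def
    by (rule SUP_upper2[of "(n, t)"]) (use t in auto)
  with t(3) show ?thesis by (meson ereal_less_eq(3) order_trans)
qed

section \<open>Angles\<close>

lemma abs_Arg_eq_arccos:
  assumes "z \<noteq> 0" shows "\<bar>Arg z\<bar> = arccos (Re z / norm z)"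
proof -
  have "Re z / norm z = cos \<bar>Arg z\<bar>" using assms by (simp add: cos_Arg)
  moreover have "arccos (cos \<bar>Arg z\<bar>) = \<bar>Arg z\<bar>"
    using Arg_bounded[of z] by (intro arccos_cos) (auto simp: abs_if)
  ultimately show ?thesis by simp
qed

text \<open>The principal argument of a product differs from the sum of the arguments by a multiple of \<open>2 \<pi>\<close>, and
  reducing a sum outside \<open>(-\<pi>,\<pi>]\<close> only makes its absolute value smaller.\<close>

lemma abs_Arg_mult_le:
  assumes "w \<noteq> 0" "z \<noteq> 0"
  shows "\<bar>Arg (w * z)\<bar> \<le> \<bar>Arg w\<bar> + \<bar>Arg z\<bar>"
  using Arg_bounded[of w] Arg_bounded[of z] pi_gt_zero
  unfolding Arg_times'[OF assms] by (auto simp: abs_if split: if_splits)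

text \<open>For \<open>x = cos \<theta>\<close> and \<open>s = sin \<theta>\<close> the first factor is the derivative of \<open>arccos (c cos \<theta>)\<close> with respect to
  \<open>\<theta>\<close>.  This is a smooth substitute for the sign of \<open>sin \<theta>\<close>: as \<open>c\<close> tends to 1 it converges to that sign, and
  its product with \<open>sin \<theta>\<close> converges to \<open>\<bar>sin \<theta>\<bar>\<close> uniformly.\<close>

lemma smoothed_sign_estimate:
  fixes c s k r :: real
  assumes c: "0 < c" "c < 1" and x: "x\<^sup>2 + s\<^sup>2 = 1" and r: "0 \<le> r"
  shows "c * s / sqrt (1 - (c * x)\<^sup>2) * (k - r * s) \<le> \<bar>k\<bar> - \<bar>r * s\<bar> + r * (sqrt (1 - c\<^sup>2) / c)"
proof -
  define q where "q = sqrt (1 - c\<^sup>2)"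
  define d where "d = sqrt (1 - (c * x)\<^sup>2)"
  have c2: "c\<^sup>2 < 1" using c by (simp add: power_less_one_iff)
  have q: "0 < q" "q\<^sup>2 = 1 - c\<^sup>2" using c2 by (auto simp: q_def)
  have x2: "x\<^sup>2 = 1 - s\<^sup>2" using x by linarith
  have eq: "1 - (c * x)\<^sup>2 = q\<^sup>2 + (c * s)\<^sup>2"
    unfolding q(2) power_mult_distrib x2 by (simp add: algebra_simps)
  have pos: "0 < q\<^sup>2 + (c * s)\<^sup>2" using q(1) by (simp add: add_pos_nonneg)
  have d: "d\<^sup>2 = q\<^sup>2 + (c * s)\<^sup>2" "0 < d"
    unfolding d_def eq using pos by simp_all
  have dle: "d \<le> q + c * \<bar>s\<bar>"
  proof (rule power2_le_imp_le)
    have "0 \<le> 2 * (q * (c * \<bar>s\<bar>))" using q c by simp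
    thus "d\<^sup>2 \<le> (q + c * \<bar>s\<bar>)\<^sup>2" unfolding d(1) by (simp add: power2_sum power_mult_distrib)
  qed (use q c in auto)
  have "\<bar>c * s\<bar> \<le> d"
  proof (rule power2_le_imp_le)
    show "\<bar>c * s\<bar>\<^sup>2 \<le> d\<^sup>2" unfolding d(1) power2_abs by simp
  qed (use d(2) in simp)
  hence "\<bar>c * s / d\<bar> \<le> 1" using d(2) by (simp add: abs_divide)
  hence "\<bar>c * s / d\<bar> * \<bar>k\<bar> \<le> 1 * \<bar>k\<bar>" by (intro mult_right_mono) auto
  hence 1: "c * s / d * k \<le> \<bar>k\<bar>" by (metis abs_ge_self abs_mult mult_1 order_trans)
  have "(c * \<bar>s\<bar> - q) * d \<le> c\<^sup>2 * s\<^sup>2"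
  proof (cases "c * \<bar>s\<bar> \<le> q")
    case True
    hence "(c * \<bar>s\<bar> - q) * d \<le> 0" using d(2) by (intro mult_nonpos_nonneg) auto
    also have "0 \<le> c\<^sup>2 * s\<^sup>2" by simp
    finally show ?thesis .
  next
    case False
    hence "(c * \<bar>s\<bar> - q) * d \<le> (c * \<bar>s\<bar> - q) * (q + c * \<bar>s\<bar>)"
      using dle by (intro mult_left_mono) auto
    also have "\<dots> = (c * \<bar>s\<bar>)\<^sup>2 - q\<^sup>2" by algebra
    also have "\<dots> \<le> c\<^sup>2 * s\<^sup>2" by (simp add: power_mult_distrib)
    finally show ?thesis .
  qed
  also have "(c * \<bar>s\<bar> - q) * d = c * ((\<bar>s\<bar> - q / c) * d)" using c by (simp add: field_simps)
  also have "c\<^sup>2 * s\<^sup>2 = c * (c * s\<^sup>2)" by (simp add: power2_eq_square)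
  finally have "(\<bar>s\<bar> - q / c) * d \<le> c * s\<^sup>2" using c by simp
  hence "\<bar>s\<bar> - q / c \<le> c * s\<^sup>2 / d" using d(2) by (simp add: pos_le_divide_eq)
  hence 2: "r * (\<bar>s\<bar> - q / c) \<le> r * (c * s\<^sup>2 / d)" using r by (rule mult_left_mono)
  have 3: "c * s / d * (k - r * s) = c * s / d * k - r * (c * s\<^sup>2 / d)"
    by (simp add: right_diff_distrib power2_eq_square)
  have 4: "\<bar>r * s\<bar> = r * \<bar>s\<bar>" using r by (simp add: abs_mult)
  show ?thesis
    unfolding d_def[symmetric] q_def[symmetric] 3 4 using 1 2
    unfolding right_diff_distrib by linarith
qed

text \<open>The argument is the imaginary part of a primitive of \<open>v'/v\<close>, because \<open>v\<close> times the exponential of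
  minus that primitive has derivative 0.\<close>

lemma continuous_argument_increment:
  fixes v v' :: "real \<Rightarrow> complex"
  assumes ab: "a \<le> b" and v: "\<And>t. t \<in> {a..b} \<Longrightarrow> (v has_vector_derivative v' t) (at t within {a..b})"
    and v': "continuous_on {a..b} v'" and nz: "\<And>t. t \<in> {a..b} \<Longrightarrow> v t \<noteq> 0"
  obtains \<theta> where "\<And>t. t \<in> {a..b} \<Longrightarrow> v t = of_real (norm (v t)) * cis (\<theta> t)"
    "\<And>t. t \<in> {a..b} \<Longrightarrow> (\<theta> has_real_derivative Im (v' t / v t)) (at t within {a..b})"
proof -
  have vc: "continuous_on {a..b} v" using v by (rule continuous_on_vector_derivative)
  define E where "E u = integral {a..u} (\<lambda>t. v' t / v t)" for u
  have E: "(E has_vector_derivative v' t / v t) (at t within {a..b})" if "t \<in> {a..b}" for t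
    unfolding E_def using that v' vc nz by (intro integral_has_vector_derivative continuous_intros) auto
  have expE: "((\<lambda>t. exp (- E t)) has_vector_derivative - (v' t / v t) * exp (- E t)) (at t within {a..b})"
    if "t \<in> {a..b}" for t
    using field_vector_diff_chain_within[OF has_vector_derivative_minus[OF E[OF that]],
            of exp "exp (- E t)"]
    by (simp add: o_def has_field_derivative_at_within)
  have "((\<lambda>t. v t * exp (- E t)) has_vector_derivative 0) (at t within {a..b})" if "t \<in> {a..b}" for t
    by (rule has_vector_derivative_eq_rhs[OF has_vector_derivative_mult[OF v[OF that] expE[OF that]]])
       (use nz[OF that] in simp)
  then obtain c where c: "\<And>t. t \<in> {a..b} \<Longrightarrow> v t * exp (- E t) = c"
    using has_vector_derivative_zero_constant[of "{a..b}" "\<lambda>t. v t * exp (- E t)"] by auto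
  have "E a = 0" by (simp add: E_def)
  hence va: "c = v a" using c[of a] ab by simp
  have veq: "v t = v a * exp (E t)" if "t \<in> {a..b}" for t
    using c[OF that] va by (simp add: exp_minus field_simps)
  define \<theta> where "\<theta> t = Arg (v a) + Im (E t)" for t
  have "v t = of_real (norm (v t)) * cis (\<theta> t)" if "t \<in> {a..b}" for t
  proof -
    have "v a * exp (E t) = (of_real (norm (v a)) * cis (Arg (v a))) * (of_real (norm (exp (E t))) * cis (Im (E t)))"
      using rcis_cmod_Arg[of "v a"] by (simp add: rcis_def exp_eq_polar[of "E t"] norm_mult)
    also have "\<dots> = of_real (norm (v a) * norm (exp (E t))) * (cis (Arg (v a)) * cis (Im (E t)))"
      by (simp only: of_real_mult mult_ac)
    also have "\<dots> = of_real (norm (v a * exp (E t))) * cis (\<theta> t)"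
      by (simp only: norm_mult cis_mult \<theta>_def)
    finally show ?thesis unfolding veq[OF that, symmetric] .
  qed
  moreover have "(\<theta> has_real_derivative Im (v' t / v t)) (at t within {a..b})" if "t \<in> {a..b}" for t
  proof -
    have "((\<lambda>t. Im (E t)) has_vector_derivative Im (v' t / v t)) (at t within {a..b})"
      using bounded_linear.has_vector_derivative[OF bounded_linear_Im E[OF that]] .
    thus ?thesis unfolding \<theta>_def has_real_derivative_iff_has_vector_derivative
      by (auto intro!: derivative_eq_intros)
  qed
  ultimately show ?thesis using that by blast
qed

text \<open>In the application \<open>v = \<gamma>'/(\<gamma> - z)\<close>, so that \<open>Im v\<close> is the angular speed of \<open>\<gamma>\<close> about \<open>z\<close>, \<open>k\<close> is the angular
  speed of the velocity, and \<open>\<theta> = arg v\<close> is the angle from the position vector to the velocity, with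
  \<open>\<theta>' = k - Im v\<close>.  The sign of \<open>Im v\<close> is that of \<open>sin \<theta>\<close>, hence \<open>\<bar>Arg v\<bar> = arccos (cos \<theta>)\<close> has derivative
  \<open>sgn (sin \<theta>) k - \<bar>Im v\<bar>\<close> wherever \<open>sin \<theta> \<noteq> 0\<close>, and the claim follows by integration.  As the zeros of \<open>sin \<theta>\<close> can
  form any closed set, \<open>arccos (c cos \<theta>)\<close> is integrated instead, with \<open>c < 1\<close>, and \<open>c\<close> tends to 1 at the end.\<close>

lemma rotation_le_turning:
  fixes v v' :: "real \<Rightarrow> complex"
  assumes ab: "a \<le> b" and v: "\<And>t. t \<in> {a..b} \<Longrightarrow> (v has_vector_derivative v' t) (at t within {a..b})"
    and v': "continuous_on {a..b} v'" and nz: "\<And>t. t \<in> {a..b} \<Longrightarrow> v t \<noteq> 0"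
    and k: "continuous_on {a..b} k" and eq: "\<And>t. t \<in> {a..b} \<Longrightarrow> Im (v' t / v t) = k t - Im (v t)"
  shows "integral {a..b} (\<lambda>t. \<bar>Im (v t)\<bar>) \<le> integral {a..b} (\<lambda>t. \<bar>k t\<bar>) + \<bar>Arg (v a)\<bar> - \<bar>Arg (v b)\<bar>"
proof -
  have vc: "continuous_on {a..b} v" using v by (rule continuous_on_vector_derivative)
  obtain \<theta> where \<theta>: "\<And>t. t \<in> {a..b} \<Longrightarrow> v t = of_real (norm (v t)) * cis (\<theta> t)"
    "\<And>t. t \<in> {a..b} \<Longrightarrow> (\<theta> has_real_derivative Im (v' t / v t)) (at t within {a..b})"
    using continuous_argument_increment[OF ab v v' nz] by blast
  hence \<theta>': "\<And>t. t \<in> {a..b} \<Longrightarrow> (\<theta> has_real_derivative k t - Im (v t)) (at t within {a..b})"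
    using eq by simp
  have \<theta>c: "continuous_on {a..b} \<theta>"
    by (rule DERIV_continuous_on[OF \<theta>'])
  have Im_v: "Im (v t) = norm (v t) * sin (\<theta> t)" and Re_v: "cos (\<theta> t) = Re (v t) / norm (v t)"
    if "t \<in> {a..b}" for t
  proof -
    have "Im (v t) = Im (of_real (norm (v t)) * cis (\<theta> t))" "Re (v t) = Re (of_real (norm (v t)) * cis (\<theta> t))"
      by (rule arg_cong[OF \<theta>(1)[OF that]])+
    hence *: "Im (v t) = norm (v t) * sin (\<theta> t)" "Re (v t) = norm (v t) * cos (\<theta> t)"
      by (simp_all only: times_complex.sel cis.sel Re_complex_of_real Im_complex_of_real mult_zero_left add_0_right diff_zero)
    show "Im (v t) = norm (v t) * sin (\<theta> t)" by (rule *(1))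
    show "cos (\<theta> t) = Re (v t) / norm (v t)"
      unfolding *(2) using nz[OF that] by simp
  qed
  define R where "R = integral {a..b} (\<lambda>t. \<bar>k t\<bar>) - integral {a..b} (\<lambda>t. \<bar>Im (v t)\<bar>)"
  define V where "V = integral {a..b} (\<lambda>t. norm (v t))"
  define F where "F c = arccos (c * cos (\<theta> b)) - arccos (c * cos (\<theta> a)) - V * (sqrt (1 - c\<^sup>2) / c)" for c
  have cos1: "\<bar>c * cos x\<bar> < 1" if "c \<in> {1/2<..<1}" for c x :: real
  proof -
    have "\<bar>c * cos x\<bar> \<le> \<bar>c\<bar> * 1" unfolding abs_mult by (intro mult_left_mono) auto
    also have "\<dots> < 1" using that by auto
    finally show ?thesis .
  qed
  have bound: "F c \<le> R" if c: "c \<in> {1/2<..<1}" for c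
  proof -
    define m where "m t = c * sin (\<theta> t) / sqrt (1 - (c * cos (\<theta> t))\<^sup>2)" for t
    have sq: "0 < 1 - (c * cos (\<theta> t))\<^sup>2" for t
      using cos1[OF c, of "\<theta> t"] by (simp add: abs_square_less_1)
    have sq0: "sqrt (1 - (c * cos (\<theta> t))\<^sup>2) \<noteq> 0" for t
      using sq[of t] by (metis less_irrefl real_sqrt_eq_zero_cancel_iff)
    have mc: "continuous_on {a..b} m" unfolding m_def
      by (intro continuous_intros \<theta>c ballI sq0)
    have "((\<lambda>t. m t * (k t - Im (v t))) has_integral
              arccos (c * cos (\<theta> b)) - arccos (c * cos (\<theta> a))) {a..b}"
    proof (rule fundamental_theorem_of_calculus[OF ab])
      fix t assume t: "t \<in> {a..b}"
      have "((\<lambda>t. c * cos (\<theta> t)) has_real_derivative c * (- sin (\<theta> t) * (k t - Im (v t)))) (at t within {a..b})"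
        by (auto intro!: derivative_eq_intros \<theta>'[OF t])
      hence "((\<lambda>t. arccos (c * cos (\<theta> t))) has_real_derivative
              inverse (- sqrt (1 - (c * cos (\<theta> t))\<^sup>2)) * (c * (- sin (\<theta> t) * (k t - Im (v t))))) (at t within {a..b})"
        by (intro DERIV_chain2[OF DERIV_arccos]) (use cos1[OF c, of "\<theta> t"] in auto)
      thus "((\<lambda>t. arccos (c * cos (\<theta> t))) has_vector_derivative m t * (k t - Im (v t))) (at t within {a..b})"
        unfolding has_real_derivative_iff_has_vector_derivative m_def
        by (simp add: divide_inverse inverse_minus_eq mult_ac)
    qed
    hence "arccos (c * cos (\<theta> b)) - arccos (c * cos (\<theta> a)) = integral {a..b} (\<lambda>t. m t * (k t - Im (v t)))"
      by (simp add: integral_unique)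
    also have "\<dots> \<le> integral {a..b} (\<lambda>t. \<bar>k t\<bar> - \<bar>Im (v t)\<bar> + norm (v t) * (sqrt (1 - c\<^sup>2) / c))"
    proof (rule integral_le)
      fix t assume t: "t \<in> {a..b}"
      show "m t * (k t - Im (v t)) \<le> \<bar>k t\<bar> - \<bar>Im (v t)\<bar> + norm (v t) * (sqrt (1 - c\<^sup>2) / c)"
        unfolding m_def Im_v[OF t] using c
        by (intro smoothed_sign_estimate) (auto simp: add.commute)
    qed (intro integrable_continuous_interval continuous_intros mc k vc)+
    also have "\<dots> = R + V * (sqrt (1 - c\<^sup>2) / c)"
      unfolding R_def V_def
      apply (subst integral_add)
        apply (intro integrable_continuous_interval continuous_intros mc k vc)+
      apply (subst integral_diff)
        apply (intro integrable_continuous_interval continuous_intros mc k vc)+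
      by simp
    finally show ?thesis by (simp add: F_def)
  qed
  have "continuous_on (closure {1/2<..<1::real}) F"
  proof -
    have *: "\<bar>x * cos y\<bar> \<le> 1" if "x \<in> {1/2..1}" for x y :: real
    proof -
      have "\<bar>x * cos y\<bar> \<le> \<bar>x\<bar> * 1" unfolding abs_mult by (intro mult_left_mono) auto
      also have "\<dots> \<le> 1" using that by auto
      finally show ?thesis .
    qed
    have **: "- 1 \<le> x * cos y \<and> x * cos y \<le> 1" if "x \<in> {1/2..1}" for x y :: real
      using *[OF that, of y] unfolding abs_le_iff by (metis minus_le_iff)
    have "closure {1/2<..<1} = {1/2..1::real}" by (rule closure_greaterThanLessThan) simp
    thus ?thesis unfolding F_def
      apply (simp only:)
      apply (intro continuous_intros ballI)
      apply (use ** in auto)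
      done
  qed
  moreover have "1 \<in> closure {1/2<..<1::real}"
    by (subst closure_greaterThanLessThan) auto
  ultimately have "F 1 \<le> R" using bound by (rule continuous_le_on_closure)
  moreover have "F 1 = \<bar>Arg (v b)\<bar> - \<bar>Arg (v a)\<bar>"
  proof -
    have mem: "a \<in> {a..b}" "b \<in> {a..b}" using ab by auto
    show ?thesis
      unfolding F_def mult_1 Re_v[OF mem(1)] Re_v[OF mem(2)]
        abs_Arg_eq_arccos[OF nz[OF mem(1)]] abs_Arg_eq_arccos[OF nz[OF mem(2)]] by simp
  qed
  ultimately have "\<bar>Arg (v b)\<bar> - \<bar>Arg (v a)\<bar> \<le> R" by (simp only:)
  thus ?thesis by (simp add: R_def)
qed

section \<open>Piecewise smooth curves\<close>

text \<open>At the ends of a piece the two-sided derivatives of \<open>\<gamma>\<close> need not exist; they agree with the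
  derivatives of the piece only inside it.\<close>

lemma smooth_piece_velocity:
  assumes piece: "smooth_piece \<gamma> a b" and ab: "a < b"
  obtains d dd where "continuous_on {a..b} d" "continuous_on {a..b} dd"
    "\<And>t. t \<in> {a..b} \<Longrightarrow> (\<gamma> has_vector_derivative d t) (at t within {a..b})"
    "\<And>t. t \<in> {a..b} \<Longrightarrow> (d has_vector_derivative dd t) (at t within {a..b})"
    "\<And>t. t \<in> {a..b} \<Longrightarrow> d t \<noteq> 0"
    "\<And>t. t \<in> {a<..<b} \<Longrightarrow> (\<gamma> has_vector_derivative d t) (at t)"
    "\<And>t. t \<in> {a<..<b} \<Longrightarrow> velocity \<gamma> t = d t"
    "\<And>t. t \<in> {a<..<b} \<Longrightarrow> vector_derivative (velocity \<gamma>) (at t) = dd t"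
    "vector_derivative \<gamma> (at_right a) = d a" "vector_derivative \<gamma> (at_left b) = d b"
proof -
  obtain d dd where dd: "continuous_on {a..b} dd"
    and D: "\<And>t. t \<in> {a..b} \<Longrightarrow> (\<gamma> has_vector_derivative d t) (at t within {a..b})"
    and DD: "\<And>t. t \<in> {a..b} \<Longrightarrow> (d has_vector_derivative dd t) (at t within {a..b})"
    and nz: "\<And>t. t \<in> {a..b} \<Longrightarrow> d t \<noteq> 0"
    using piece unfolding smooth_piece_def by blast
  have d: "continuous_on {a..b} d" using DD by (rule continuous_on_vector_derivative)
  have at: "(\<gamma> has_vector_derivative d t) (at t)" "(d has_vector_derivative dd t) (at t)"
    if "t \<in> {a<..<b}" for t
    using D[of t] DD[of t] that by (auto simp: at_within_Icc_at)
  have vel: "velocity \<gamma> t = d t" if "t \<in> {a<..<b}" for t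
    unfolding velocity_def using at(1)[OF that] by (rule vector_derivative_at)
  have "vector_derivative (velocity \<gamma>) (at t) = dd t" if t: "t \<in> {a<..<b}" for t
    by (intro vector_derivative_at has_vector_derivative_transform_within_open[OF at(2)[OF t] _ t])
       (auto simp: vel)
  moreover have "vector_derivative \<gamma> (at_right a) = d a" "vector_derivative \<gamma> (at_left b) = d b"
    using D[of a] D[of b] ab
    by (auto simp: at_within_Icc_at_right at_within_Icc_at_left intro!: vector_derivative_within)
  ultimately show ?thesis using that[OF d dd D DD nz at(1) vel] by blast
qed

lemma smooth_piece_speed_integrable:
  assumes piece: "smooth_piece \<gamma> a b" and ab: "a < b"
  shows "(\<lambda>t. norm (velocity \<gamma> t)) integrable_on {a..b}"
proof -
  obtain d where d: "continuous_on {a..b} d" "\<And>t. t \<in> {a<..<b} \<Longrightarrow> velocity \<gamma> t = d t"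
    using smooth_piece_velocity[OF piece ab] by metis
  have "(\<lambda>t. norm (d t)) integrable_on {a..b}"
    using d by (intro integrable_continuous_interval continuous_intros)
  thus ?thesis
    by (rule integrable_spike_finite[of "{a, b}", rotated 2]) (auto simp: d(2))
qed

text \<open>Instance of \<open>rotation_le_turning\<close>: for \<open>v = \<gamma>'/(\<gamma> - z)\<close> one has \<open>v'/v = \<gamma>''/\<gamma>' - v\<close>, and
  \<open>\<bar>Im (\<gamma>''/\<gamma>')\<bar>\<close> is the curvature times the speed.\<close>

lemma smooth_piece_rotation:
  assumes piece: "smooth_piece \<gamma> a b" and ab: "a < b" and z: "z \<notin> \<gamma> ` {a..b}"
  shows "(\<lambda>t. \<bar>Im (velocity \<gamma> t / (\<gamma> t - z))\<bar>) integrable_on {a..b}" (is ?A)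
    and "(\<lambda>t. abs_curvature \<gamma> t * norm (velocity \<gamma> t)) integrable_on {a..b}" (is ?B)
    and "integral {a..b} (\<lambda>t. \<bar>Im (velocity \<gamma> t / (\<gamma> t - z))\<bar>)
       \<le> integral {a..b} (\<lambda>t. abs_curvature \<gamma> t * norm (velocity \<gamma> t))
         + \<bar>Arg (vector_derivative \<gamma> (at_right a) / (\<gamma> a - z))\<bar>
         - \<bar>Arg (vector_derivative \<gamma> (at_left b) / (\<gamma> b - z))\<bar>" (is ?C)
proof -
  obtain d dd where d: "continuous_on {a..b} d" "continuous_on {a..b} dd"
    and D: "\<And>t. t \<in> {a..b} \<Longrightarrow> (\<gamma> has_vector_derivative d t) (at t within {a..b})"
    and DD: "\<And>t. t \<in> {a..b} \<Longrightarrow> (d has_vector_derivative dd t) (at t within {a..b})"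
    and nz: "\<And>t. t \<in> {a..b} \<Longrightarrow> d t \<noteq> 0"
    and vel: "\<And>t. t \<in> {a<..<b} \<Longrightarrow> velocity \<gamma> t = d t"
    and acc: "\<And>t. t \<in> {a<..<b} \<Longrightarrow> vector_derivative (velocity \<gamma>) (at t) = dd t"
    and ends: "vector_derivative \<gamma> (at_right a) = d a" "vector_derivative \<gamma> (at_left b) = d b"
    using smooth_piece_velocity[OF piece ab] by metis
  have gc: "continuous_on {a..b} \<gamma>" using D by (rule continuous_on_vector_derivative)
  have gz: "\<gamma> t - z \<noteq> 0" if "t \<in> {a..b}" for t using z that by auto
  define v where "v t = d t / (\<gamma> t - z)" for t
  define v' where "v' t = dd t / (\<gamma> t - z) - v t * v t" for t
  define k where "k t = Im (dd t / d t)" for t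
  have vc: "continuous_on {a..b} v" unfolding v_def by (intro continuous_intros d gc gz ballI)
  have v'c: "continuous_on {a..b} v'" unfolding v'_def by (intro continuous_intros d gc gz vc ballI)
  have kc: "continuous_on {a..b} k" unfolding k_def by (intro continuous_intros d ballI nz)
  have vD: "(v has_vector_derivative v' t) (at t within {a..b})" if t: "t \<in> {a..b}" for t
  proof -
    have 1: "((\<lambda>t. \<gamma> t - z) has_vector_derivative d t) (at t within {a..b})"
      using D[OF t] by (auto intro!: derivative_eq_intros)
    have "((\<lambda>x. inverse x) has_field_derivative - (inverse (\<gamma> t - z) ^ 2)) (at (\<gamma> t - z))"
      using gz[OF t] by (auto intro!: derivative_eq_intros simp: power2_eq_square)
    from field_vector_diff_chain_within[OF 1 has_field_derivative_at_within[OF this]]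
    have 2: "((\<lambda>t. inverse (\<gamma> t - z)) has_vector_derivative d t * - (inverse (\<gamma> t - z) ^ 2)) (at t within {a..b})"
      by (simp add: o_def)
    show ?thesis unfolding v_def divide_inverse
      by (rule has_vector_derivative_eq_rhs[OF has_vector_derivative_mult[OF DD[OF t] 2]])
         (simp add: v'_def v_def divide_inverse power2_eq_square algebra_simps)
  qed
  have vnz: "v t \<noteq> 0" if "t \<in> {a..b}" for t using nz[OF that] gz[OF that] by (simp add: v_def)
  have eq: "Im (v' t / v t) = k t - Im (v t)" if t: "t \<in> {a..b}" for t
  proof -
    have "v' t / v t = dd t / (\<gamma> t - z) / v t - v t"
      using vnz[OF t] by (simp add: v'_def diff_divide_distrib)
    also have "dd t / (\<gamma> t - z) / v t = dd t / d t"
      using gz[OF t] by (simp add: v_def)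
    finally show ?thesis by (simp add: k_def)
  qed
  have curv: "abs_curvature \<gamma> t * norm (velocity \<gamma> t) = \<bar>k t\<bar>" if t: "t \<in> {a<..<b}" for t
  proof -
    have t': "t \<in> {a..b}" using t by auto
    have "Im (dd t / d t) = Im (cnj (d t) * dd t) / (norm (d t))\<^sup>2"
      by (simp add: complex_div_cnj[of "dd t"] mult.commute)
    thus ?thesis using nz[OF t'] unfolding abs_curvature_def vel[OF t] acc[OF t] k_def
      by (simp add: abs_divide power2_eq_square power3_eq_cube)
  qed
  have rot: "\<bar>Im (velocity \<gamma> t / (\<gamma> t - z))\<bar> = \<bar>Im (v t)\<bar>" if "t \<in> {a<..<b}" for t
    by (simp add: vel[OF that] v_def)
  have "(\<lambda>t. \<bar>Im (v t)\<bar>) integrable_on {a..b}"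
    by (intro integrable_continuous_interval continuous_intros vc)
  thus ?A by (rule integrable_spike_finite[of "{a, b}", rotated 2]) (use rot in auto)
  have "(\<lambda>t. \<bar>k t\<bar>) integrable_on {a..b}"
    by (intro integrable_continuous_interval continuous_intros kc)
  thus ?B by (rule integrable_spike_finite[of "{a, b}", rotated 2]) (use curv in auto)
  have neg: "negligible {a, b}" by (simp add: negligible_finite)
  have I1: "integral {a..b} (\<lambda>t. \<bar>Im (velocity \<gamma> t / (\<gamma> t - z))\<bar>) = integral {a..b} (\<lambda>t. \<bar>Im (v t)\<bar>)"
    by (rule integral_spike[OF neg]) (use rot in auto)
  have I2: "integral {a..b} (\<lambda>t. abs_curvature \<gamma> t * norm (velocity \<gamma> t)) = integral {a..b} (\<lambda>t. \<bar>k t\<bar>)"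
    by (rule integral_spike[OF neg]) (use curv in auto)
  show ?C unfolding I1 I2 ends
    using rotation_le_turning[OF less_imp_le[OF ab] vD v'c vnz kc eq] by (simp add: v_def)
qed

lemma integral_over_pieces:
  fixes g :: "real \<Rightarrow> real" and t :: "nat \<Rightarrow> real"
  assumes "\<And>i. i < n \<Longrightarrow> t i \<le> t (Suc i)" "\<And>i. i < n \<Longrightarrow> g integrable_on {t i..t (Suc i)}"
  shows "t 0 \<le> t n \<and> g integrable_on {t 0..t n} \<and>
         integral {t 0..t n} g = (\<Sum>i<n. integral {t i..t (Suc i)} g)"
  using assms
proof (induction n)
  case (Suc n)
  have IH: "t 0 \<le> t n" "g integrable_on {t 0..t n}"
     "integral {t 0..t n} g = (\<Sum>i<n. integral {t i..t (Suc i)} g)"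
    using Suc by auto
  have le: "t n \<le> t (Suc n)" and int: "g integrable_on {t n..t (Suc n)}" using Suc.prems by auto
  have "g integrable_on {t 0..t (Suc n)}"
    by (rule Henstock_Kurzweil_Integration.integrable_combine[OF IH(1) le IH(2) int])
  moreover from this have "integral {t 0..t (Suc n)} g = integral {t 0..t n} g + integral {t n..t (Suc n)} g"
    using IH(1) le by (simp add: Henstock_Kurzweil_Integration.integral_combine)
  ultimately show ?case using IH le by simp
qed (use integrable_on_refl[of g "t 0"] in auto)

lemma piece_containing:
  fixes t :: "nat \<Rightarrow> real"
  assumes "t 0 \<le> s" "s \<le> t n" "0 < n"
  shows "\<exists>i<n. t i \<le> s \<and> s \<le> t (Suc i)"
  using assms
proof (induction n)
  case (Suc n)
  show ?case
  proof (cases "s \<le> t n \<and> 0 < n")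
    case True
    then show ?thesis using Suc by (meson less_SucI)
  next
    case False
    then show ?thesis using Suc.prems by (intro exI[of _ n]) (cases "n = 0", auto)
  qed
qed auto

lemma piecewise_smoothE:
  assumes "piecewise_smooth \<gamma>"
  obtains n and t :: "nat \<Rightarrow> real" where "0 < n" "t 0 = 0" "t n = 1"
    "\<And>i. i < n \<Longrightarrow> t i < t (Suc i)" "\<And>i. i < n \<Longrightarrow> smooth_piece \<gamma> (t i) (t (Suc i))"
    "\<And>i j. i < j \<Longrightarrow> j \<le> n \<Longrightarrow> t i < t j"
    "\<And>s. s \<in> {0..1} - t ` {..n} \<Longrightarrow> \<exists>i<n. s \<in> {t i<..<t (Suc i)}"
proof -
  obtain n and t :: "nat \<Rightarrow> real" where t: "t 0 = 0" "t n = 1"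
    "\<And>i. i < n \<Longrightarrow> t i < t (Suc i)" "\<And>i. i < n \<Longrightarrow> smooth_piece \<gamma> (t i) (t (Suc i))"
    using assms unfolding piecewise_smooth_def by blast
  have n: "0 < n" using t(1,2) by (cases n) auto
  have mono: "t i < t j" if "i < j" "j \<le> n" for i j
    using that
  proof (induction j)
    case (Suc j)
    thus ?case using t(3)[of j] by (cases "i = j") (auto intro: less_trans)
  qed auto
  have "\<exists>i<n. s \<in> {t i<..<t (Suc i)}" if s: "s \<in> {0..1} - t ` {..n}" for s
  proof -
    obtain i where i: "i < n" "t i \<le> s" "s \<le> t (Suc i)"
      using piece_containing[of t s n] s t(1,2) n by auto
    have "s \<noteq> t i" "s \<noteq> t (Suc i)" using s i(1) by auto
    with i show ?thesis by (intro exI[of _ i]) auto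
  qed
  with n t mono show ?thesis using that by blast
qed

lemma piecewise_smooth_velocity:
  assumes "piecewise_smooth \<gamma>"
  obtains T where "finite T" "\<And>s. s \<in> {0..1} - T \<Longrightarrow> (\<gamma> has_vector_derivative velocity \<gamma> s) (at s)"
    "(\<lambda>s. norm (velocity \<gamma> s)) integrable_on {0..1}" "valid_path \<gamma>"
proof -
  obtain n and t :: "nat \<Rightarrow> real" where n: "0 < n" "t 0 = 0" "t n = 1"
    and lt: "\<And>i. i < n \<Longrightarrow> t i < t (Suc i)"
    and pc: "\<And>i. i < n \<Longrightarrow> smooth_piece \<gamma> (t i) (t (Suc i))"
    and mono: "\<And>i j. i < j \<Longrightarrow> j \<le> n \<Longrightarrow> t i < t j"
    and cover: "\<And>s. s \<in> {0..1} - t ` {..n} \<Longrightarrow> \<exists>i<n. s \<in> {t i<..<t (Suc i)}"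
    using piecewise_smoothE[OF assms] by metis
  have vel: "(\<gamma> has_vector_derivative velocity \<gamma> s) (at s) \<and> isCont (velocity \<gamma>) s"
    if s: "s \<in> {0..1} - t ` {..n}" for s
  proof -
    obtain i where i: "i < n" "s \<in> {t i<..<t (Suc i)}" using cover[OF s] by blast
    obtain d where d: "continuous_on {t i..t (Suc i)} d"
      "\<And>s. s \<in> {t i<..<t (Suc i)} \<Longrightarrow> (\<gamma> has_vector_derivative d s) (at s)"
      "\<And>s. s \<in> {t i<..<t (Suc i)} \<Longrightarrow> velocity \<gamma> s = d s"
      using smooth_piece_velocity[OF pc[OF i(1)] lt[OF i(1)]] by metis
    have "continuous_on {t i<..<t (Suc i)} d" using d(1) by (rule continuous_on_subset) auto
    hence "continuous_on {t i<..<t (Suc i)} (velocity \<gamma>)" by (rule continuous_on_eq) (simp add: d(3))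
    hence "isCont (velocity \<gamma>) s" using i(2) by (simp add: continuous_on_eq_continuous_at)
    thus ?thesis using d(2)[OF i(2)] d(3)[OF i(2)] by simp
  qed
  have "(\<lambda>s. norm (velocity \<gamma> s)) integrable_on {0..1}"
    using integral_over_pieces[of n t "\<lambda>s. norm (velocity \<gamma> s)"] less_imp_le[OF lt] n
      smooth_piece_speed_integrable[OF pc lt] by auto
  moreover have "valid_path \<gamma>"
    unfolding valid_path_def piecewise_C1_differentiable_on_def C1_differentiable_on_def
  proof (intro conjI exI ballI)
    show "continuous_on {0..1} \<gamma>" using assms by (simp add: piecewise_smooth_def path_def)
    show "finite (t ` {..n})" by simp
    show "(\<gamma> has_vector_derivative velocity \<gamma> s) (at s)" if "s \<in> {0..1} - t ` {..n}" for s
      using vel[OF that] by simp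
    show "continuous_on ({0..1} - t ` {..n}) (velocity \<gamma>)"
      using vel by (intro continuous_at_imp_continuous_on) auto
  qed
  ultimately show ?thesis using that[of "t ` {..n}"] vel by auto
qed

text \<open>The upper bound holds because a chord is at most the integral of the speed over its arc.  For the lower
  bound, uniform continuity of the velocity on each piece makes the chord of a short arc of duration \<open>h\<close> at
  least the integral of the speed minus \<open>2 \<eta> h\<close>, and such arcs are chained from the start of the curve to
  its end.\<close>

lemma curve_length_eq_integral:
  assumes g: "piecewise_smooth \<gamma>"
  shows "curve_length \<gamma> = ereal (integral {0..1} (\<lambda>s. norm (velocity \<gamma> s)))"
proof (rule antisym)
  obtain T where T: "finite T" "\<And>s. s \<in> {0..1} - T \<Longrightarrow> (\<gamma> has_vector_derivative velocity \<gamma> s) (at s)"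
    and int: "(\<lambda>s. norm (velocity \<gamma> s)) integrable_on {0..1}"
    using piecewise_smooth_velocity[OF g] by metis
  define F where "F u = integral {0..u} (\<lambda>s. norm (velocity \<gamma> s))" for u
  have gc: "continuous_on {0..1} \<gamma>" using g by (simp add: piecewise_smooth_def path_def)
  have sub: "(\<lambda>s. norm (velocity \<gamma> s)) integrable_on {s..u}" if "0 \<le> s" "u \<le> 1" for s u
    using int by (rule integrable_on_subinterval) (use that in auto)
  have F: "F u - F s = integral {s..u} (\<lambda>s. norm (velocity \<gamma> s))" if "0 \<le> s" "s \<le> u" "u \<le> 1" for s u
    using Henstock_Kurzweil_Integration.integral_combine[OF that(1,2) sub[OF order_refl that(3)]] by (simp add: F_def)
  have ftc: "(velocity \<gamma> has_integral (\<gamma> u - \<gamma> s)) {s..u}" if "0 \<le> s" "s \<le> u" "u \<le> 1" for s u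
    using T that
    by (intro fundamental_theorem_of_calculus_interior_strong[OF T(1)])
       (auto intro: continuous_on_subset[OF gc])
  have "curve_length \<gamma> \<le> ereal (F 1 - F 0)"
  proof (rule total_variation_le_increment)
    fix s u :: real assume su: "0 \<le> s" "s \<le> u" "u \<le> 1"
    have "norm (\<gamma> u - \<gamma> s) \<le> F u - F s"
      unfolding F[OF su] integral_unique[OF ftc[OF su], symmetric]
      using ftc[OF su] sub[of s u] su by (intro integral_norm_bound_integral) auto
    thus "dist (\<gamma> s) (\<gamma> u) \<le> F u - F s" by (simp add: dist_norm norm_minus_commute)
  qed
  thus "curve_length \<gamma> \<le> ereal (integral {0..1} (\<lambda>s. norm (velocity \<gamma> s)))" by (simp add: F_def)
  obtain n and t :: "nat \<Rightarrow> real" where n: "0 < n" "t 0 = 0" "t n = 1"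
    and lt: "\<And>i. i < n \<Longrightarrow> t i < t (Suc i)"
    and pc: "\<And>i. i < n \<Longrightarrow> smooth_piece \<gamma> (t i) (t (Suc i))"
    and mono: "\<And>i j. i < j \<Longrightarrow> j \<le> n \<Longrightarrow> t i < t j"
    using piecewise_smoothE[OF g] by metis
  have reach: "polygon_reaches \<gamma> 1 (F 1 - 2 * \<eta>)" if \<eta>: "0 < \<eta>" for \<eta>
  proof -
    have chord: "\<exists>\<delta>>0. \<forall>s u. t i \<le> s \<longrightarrow> s \<le> u \<longrightarrow> u \<le> t (Suc i) \<longrightarrow> u - s < \<delta> \<longrightarrow>
        F u - F s - 2 * \<eta> * (u - s) \<le> dist (\<gamma> s) (\<gamma> u)" if i: "i < n" for i
    proof -
      have t01: "0 \<le> t i" "t (Suc i) \<le> 1"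
        using mono[of 0 i] mono[of "Suc i" n] n i by (cases "i = 0"; cases "Suc i = n"; force)+
      obtain d where d: "continuous_on {t i..t (Suc i)} d"
        "\<And>s. s \<in> {t i<..<t (Suc i)} \<Longrightarrow> velocity \<gamma> s = d s"
        using smooth_piece_velocity[OF pc[OF i] lt[OF i]] by metis
      have "uniformly_continuous_on {t i..t (Suc i)} d"
        using d(1) by (simp add: compact_uniformly_continuous)
      then obtain \<delta> where \<delta>: "\<delta> > 0" "\<And>s u. s \<in> {t i..t (Suc i)} \<Longrightarrow> u \<in> {t i..t (Suc i)} \<Longrightarrow>
          dist u s < \<delta> \<Longrightarrow> dist (d u) (d s) < \<eta>"
        using \<eta> unfolding uniformly_continuous_on_def by metis
      have "F u - F s - 2 * \<eta> * (u - s) \<le> dist (\<gamma> s) (\<gamma> u)"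
        if su: "t i \<le> s" "s \<le> u" "u \<le> t (Suc i)" "u - s < \<delta>" for s u
      proof -
        have su': "0 \<le> s" "s \<le> u" "u \<le> 1" using su t01 by auto
        have near: "norm (velocity \<gamma> x - d s) \<le> \<eta>" if x: "x \<in> {s..u} - {s, u}" for x
          using \<delta>(2)[of s x] su x d(2)[of x] by (auto simp: dist_norm)
        have "((\<lambda>x. velocity \<gamma> x - d s) has_integral (\<gamma> u - \<gamma> s) - (u - s) *\<^sub>R d s) {s..u}"
          using has_integral_diff[OF ftc[OF su'] has_integral_const_real[of "d s" s u]] su'(2) by simp
        hence "norm ((\<gamma> u - \<gamma> s) - (u - s) *\<^sub>R d s) \<le> \<eta> * (u - s)"
          using has_integral_bound_spike_finite[where S = "{s, u}" and B = \<eta> and a = s and b = u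
              and f = "\<lambda>x. velocity \<gamma> x - d s"] \<eta> near su'(2) by auto
        hence 1: "(u - s) * norm (d s) - \<eta> * (u - s) \<le> norm (\<gamma> u - \<gamma> s)"
          using norm_triangle_ineq2[of "(u - s) *\<^sub>R d s" "\<gamma> u - \<gamma> s"] su'(2)
          by (simp add: norm_minus_commute)
        have "((\<lambda>x. norm (velocity \<gamma> x)) has_integral (F u - F s)) {s..u}"
          unfolding F[OF su'] using sub[of s u] su' by (simp add: integrable_integral)
        hence "((\<lambda>x. if x \<in> {s, u} then 0 else norm (velocity \<gamma> x)) has_integral (F u - F s)) {s..u}"
          by (rule has_integral_spike_finite[of "{s, u}", rotated 2]) auto
        moreover have "((\<lambda>x. norm (d s) + \<eta>) has_integral (u - s) * (norm (d s) + \<eta>)) {s..u}"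
          using has_integral_const_real[of "norm (d s) + \<eta>" s u] su'(2) by simp
        moreover have "(if x \<in> {s, u} then 0 else norm (velocity \<gamma> x)) \<le> norm (d s) + \<eta>" if "x \<in> {s..u}" for x
          using near[of x] that \<eta> norm_triangle_ineq2[of "velocity \<gamma> x" "d s"] by auto
        ultimately have 2: "F u - F s \<le> (u - s) * (norm (d s) + \<eta>)"
          by (rule has_integral_le)
        show ?thesis using 1 2 by (simp add: dist_norm norm_minus_commute algebra_simps)
      qed
      thus ?thesis using \<delta>(1) by blast
    qed
    have "polygon_reaches \<gamma> (t k) (F (t k) - 2 * \<eta> * t k)" if "k \<le> n" for k
      using that
    proof (induction k)
      case 0
      show ?case using polygon_reaches_0[of \<gamma>] n by (simp add: F_def)
    next
      case (Suc k)
      hence k: "k < n" by simp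
      have tk: "0 \<le> t k" using mono[of 0 k] n k by (cases "k = 0") auto
      obtain \<delta> where \<delta>: "\<delta> > 0" "\<And>s u. t k \<le> s \<Longrightarrow> s \<le> u \<Longrightarrow> u \<le> t (Suc k) \<Longrightarrow> u - s < \<delta> \<Longrightarrow>
          F u - F s - 2 * \<eta> * (u - s) \<le> dist (\<gamma> s) (\<gamma> u)"
        using chord[OF k] by blast
      obtain N :: nat where N: "(t (Suc k) - t k) / \<delta> < real N" using reals_Archimedean2 by blast
      define w where "w = (t (Suc k) - t k) / real N"
      have "0 < (t (Suc k) - t k) / \<delta>" using lt[OF k] \<delta>(1) by simp
      hence Npos: "0 < real N" using N by linarith
      have w: "0 < w" "w < \<delta>" "t k + real N * w = t (Suc k)"
        using N Npos lt[OF k] \<delta>(1) by (auto simp: w_def field_simps)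
      \<comment> \<open>The piece is cut into \<open>N\<close> arcs of duration \<open>w < \<delta>\<close>.\<close>
      have "polygon_reaches \<gamma> (t k + real j * w) (F (t k + real j * w) - 2 * \<eta> * (t k + real j * w))"
        if "j \<le> N" for j
        using that
      proof (induction j)
        case 0
        show ?case using Suc by simp
      next
        case (Suc j)
        have "real (Suc j) * w \<le> real N * w" using Suc.prems w(1) by (intro mult_right_mono) auto
        hence le: "t k + real (Suc j) * w \<le> t (Suc k)" using w(3) by linarith
        have step: "t k + real (Suc j) * w = (t k + real j * w) + w" by (simp add: algebra_simps)
        have pos: "0 \<le> real j * w" using w(1) by simp
        show ?case
        proof (rule polygon_reaches_extend)
          show "polygon_reaches \<gamma> (t k + real j * w) (F (t k + real j * w) - 2 * \<eta> * (t k + real j * w))"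
            using Suc by simp
          show "F (t k + real (Suc j) * w) - 2 * \<eta> * (t k + real (Suc j) * w) \<le>
              F (t k + real j * w) - 2 * \<eta> * (t k + real j * w) +
              dist (\<gamma> (t k + real j * w)) (\<gamma> (t k + real (Suc j) * w))"
            using \<delta>(2)[of "t k + real j * w" "t k + real (Suc j) * w"] le pos w(1,2) unfolding step
            by (simp add: algebra_simps)
        qed (use tk pos w(1) in \<open>auto simp: step\<close>)
      qed
      from this[of N] show ?case using w(3) by simp
    qed
    from this[of n] show ?thesis using n by simp
  qed
  show "ereal (integral {0..1} (\<lambda>s. norm (velocity \<gamma> s))) \<le> curve_length \<gamma>"
  proof (rule ereal_le_epsilon2)
    fix e :: real assume "0 < e"
    hence "ereal (F 1 - e) \<le> curve_length \<gamma>"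
      using polygon_reaches_le_total_variation[OF reach[of "e / 2"]] by simp
    hence "ereal (F 1 - e) + ereal e \<le> curve_length \<gamma> + ereal e" by (rule add_right_mono)
    thus "ereal (integral {0..1} (\<lambda>s. norm (velocity \<gamma> s))) \<le> curve_length \<gamma> + ereal e"
      by (simp add: F_def)
  qed
qed

text \<open>At a parameter inside a smooth piece both one-sided velocities agree and the turning angle is 0, so
  only break points contribute.\<close>

lemma sum_turning_angle:
  assumes n: "0 < n" "t 0 = 0" "t n = 1" and pc: "\<And>i. i < n \<Longrightarrow> smooth_piece \<gamma> (t i) (t (Suc i))"
    and mono: "\<And>i j. i < j \<Longrightarrow> j \<le> n \<Longrightarrow> t i < (t j :: real)"
    and cover: "\<And>s. s \<in> {0..1} - t ` {..n} \<Longrightarrow> \<exists>i<n. s \<in> {t i<..<t (Suc i)}"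
  shows "(\<Sum>s | s \<in> {0<..<1} \<and> turning_angle \<gamma> s \<noteq> 0. turning_angle \<gamma> s)
       = (\<Sum>i\<in>{1..<n}. turning_angle \<gamma> (t i))"
proof -
  have inj: "inj_on t {1..<n}"
    by (rule inj_onI) (metis atLeastLessThan_iff less_imp_le linorder_neqE_nat mono order_less_irrefl)
  have "(\<Sum>s | s \<in> {0<..<1} \<and> turning_angle \<gamma> s \<noteq> 0. turning_angle \<gamma> s) = sum (turning_angle \<gamma>) (t ` {1..<n})"
  proof (rule sum.mono_neutral_left)
    show "{s \<in> {0<..<1}. turning_angle \<gamma> s \<noteq> 0} \<subseteq> t ` {1..<n}"
    proof (rule subsetI, rule ccontr)
      fix s assume s: "s \<in> {s \<in> {0<..<1}. turning_angle \<gamma> s \<noteq> 0}" and no: "s \<notin> t ` {1..<n}"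
      have "s \<notin> t ` {..n}"
      proof
        assume "s \<in> t ` {..n}"
        then obtain i where i: "i \<le> n" "s = t i" by auto
        show False
        proof (cases "i = 0 \<or> i = n")
          case True
          then show ?thesis using i s n by auto
        next
          case False
          then show ?thesis using i no by auto
        qed
      qed
      hence "s \<in> {0..1} - t ` {..n}" using s by auto
      then obtain i where i: "i < n" "s \<in> {t i<..<t (Suc i)}" using cover by metis
      have lt: "t i < t (Suc i)" using i by auto
      obtain d where "d s \<noteq> 0" "(\<gamma> has_vector_derivative d s) (at s)"
        using smooth_piece_velocity[OF pc[OF i(1)] lt] i(2)
        by (metis greaterThanLessThan_subseteq_atLeastAtMost_iff order_refl subsetD)
      hence "vector_derivative \<gamma> (at_right s) = d s" "vector_derivative \<gamma> (at_left s) = d s"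
        by (auto intro!: vector_derivative_within has_vector_derivative_at_within)
      hence "turning_angle \<gamma> s = 0" using \<open>d s \<noteq> 0\<close> by (simp add: turning_angle_def)
      thus False using s by auto
    qed
    show "\<forall>i\<in>t ` {1..<n} - {s \<in> {0<..<1}. turning_angle \<gamma> s \<noteq> 0}. turning_angle \<gamma> i = 0"
    proof
      fix s assume s: "s \<in> t ` {1..<n} - {s \<in> {0<..<1}. turning_angle \<gamma> s \<noteq> 0}"
      then obtain i where i: "i \<in> {1..<n}" "s = t i" by auto
      have "s \<in> {0<..<1}" using mono[of 0 i] mono[of i n] i n by auto
      thus "turning_angle \<gamma> s = 0" using s by auto
    qed
  qed auto
  also have "\<dots> = (\<Sum>i\<in>{1..<n}. turning_angle \<gamma> (t i))" by (subst sum.reindex[OF inj]) simp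
  finally show ?thesis .
qed

text \<open>On each piece the rotation about \<open>z\<close> is bounded by the curvature integral plus the drop of the angle in
  \<open>[0,\<pi>]\<close> between position vector and velocity.  At a vertex this angle jumps by at most the turning angle.
  The sum therefore telescopes, and the initial angle is at most \<open>\<pi>\<close>.\<close>

lemma rotation_le_total_curvature:
  assumes g: "piecewise_smooth \<gamma>" and z: "z \<notin> path_image \<gamma>"
  shows "(\<lambda>t. \<bar>Im (velocity \<gamma> t / (\<gamma> t - z))\<bar>) integrable_on {0..1}"
    and "integral {0..1} (\<lambda>t. \<bar>Im (velocity \<gamma> t / (\<gamma> t - z))\<bar>) \<le> total_curvature \<gamma> + pi"
    and "0 \<le> total_curvature \<gamma>"
proof -
  obtain n and t :: "nat \<Rightarrow> real" where n: "0 < n" "t 0 = 0" "t n = 1"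
    and lt: "\<And>i. i < n \<Longrightarrow> t i < t (Suc i)"
    and pc: "\<And>i. i < n \<Longrightarrow> smooth_piece \<gamma> (t i) (t (Suc i))"
    and mono: "\<And>i j. i < j \<Longrightarrow> j \<le> n \<Longrightarrow> t i < t j"
    and cover: "\<And>s. s \<in> {0..1} - t ` {..n} \<Longrightarrow> \<exists>i<n. s \<in> {t i<..<t (Suc i)}"
    using piecewise_smoothE[OF g] by metis
  have t01: "{t i..t (Suc i)} \<subseteq> {0..1}" if "i < n" for i
    using mono[of 0 i] mono[of "Suc i" n] n that by (cases "i = 0"; cases "Suc i = n") auto
  have zi: "z \<notin> \<gamma> ` {t i..t (Suc i)}" if "i < n" for i
    using z t01[OF that] by (auto simp: path_image_def)
  define R where "R s = \<bar>Im (velocity \<gamma> s / (\<gamma> s - z))\<bar>" for s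
  define K where "K s = abs_curvature \<gamma> s * norm (velocity \<gamma> s)" for s
  define P where "P i = \<bar>Arg (vector_derivative \<gamma> (at_right (t i)) / (\<gamma> (t i) - z))\<bar>" for i
  define Q where "Q i = \<bar>Arg (vector_derivative \<gamma> (at_left (t (Suc i))) / (\<gamma> (t (Suc i)) - z))\<bar>" for i
  note piece = smooth_piece_rotation[OF pc lt zi, folded R_def K_def P_def Q_def]
  have totR: "R integrable_on {0..1}" "integral {0..1} R = (\<Sum>i<n. integral {t i..t (Suc i)} R)"
    using integral_over_pieces[of n t R] less_imp_le[OF lt] piece(1) n unfolding R_def[abs_def] by auto
  have totK: "K integrable_on {0..1}" "integral {0..1} K = (\<Sum>i<n. integral {t i..t (Suc i)} K)"
    using integral_over_pieces[of n t K] less_imp_le[OF lt] piece(2) n unfolding K_def[abs_def] by auto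
  have jump: "P i \<le> Q (i - 1) + turning_angle \<gamma> (t i)" if i: "0 < i" "i < n" for i
  proof -
    obtain dR where dR: "vector_derivative \<gamma> (at_right (t i)) = dR" "dR \<noteq> 0"
      using smooth_piece_velocity[OF pc[OF i(2)] lt[OF i(2)]]
      by (metis atLeastAtMost_iff less_imp_le lt i(2) order_refl)
    have i': "i - 1 < n" "Suc (i - 1) = i" using i by auto
    obtain dL where dL: "vector_derivative \<gamma> (at_left (t i)) = dL" "dL \<noteq> 0"
      using smooth_piece_velocity[OF pc[OF i'(1)] lt[OF i'(1)]] unfolding i'(2)
      by (metis atLeastAtMost_iff less_imp_le lt i' order_refl)
    have gz: "\<gamma> (t i) - z \<noteq> 0" using zi[OF i(2)] lt[OF i(2)] by auto
    have "dR / (\<gamma> (t i) - z) = (dL / (\<gamma> (t i) - z)) * (dR / dL)" using dL by simp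
    hence "\<bar>Arg (dR / (\<gamma> (t i) - z))\<bar> \<le> \<bar>Arg (dL / (\<gamma> (t i) - z))\<bar> + \<bar>Arg (dR / dL)\<bar>"
      using abs_Arg_mult_le[of "dL / (\<gamma> (t i) - z)" "dR / dL"] dL(2) dR(2) gz by simp
    thus ?thesis unfolding P_def Q_def turning_angle_def i'(2) dR(1) dL(1) .
  qed
  have sum: "(\<Sum>i<Suc k. P i - Q i) \<le> pi + (\<Sum>i\<in>{1..<Suc k}. turning_angle \<gamma> (t i)) - Q k" if "k < n" for k
    using that
  proof (induction k)
    case 0
    have "P 0 \<le> pi" using Arg_bounded[of "vector_derivative \<gamma> (at_right (t 0)) / (\<gamma> (t 0) - z)"]
      by (auto simp: P_def abs_if)
    thus ?case by simp
  next
    case (Suc k)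
    have "(\<Sum>i\<in>{1..<Suc (Suc k)}. turning_angle \<gamma> (t i)) =
          (\<Sum>i\<in>{1..<Suc k}. turning_angle \<gamma> (t i)) + turning_angle \<gamma> (t (Suc k))" by simp
    moreover have "(\<Sum>i<Suc (Suc k). P i - Q i) = (\<Sum>i<Suc k. P i - Q i) + (P (Suc k) - Q (Suc k))" by simp
    ultimately show ?case using Suc jump[of "Suc k"] by simp
  qed
  obtain m where m: "n = Suc m" using n(1) by (cases n) auto
  have Q0: "0 \<le> Q m" by (simp add: Q_def)
  have turn: "total_curvature \<gamma> = integral {0..1} K + (\<Sum>i\<in>{1..<n}. turning_angle \<gamma> (t i))"
    by (simp only: total_curvature_def K_def[abs_def] sum_turning_angle[OF n pc mono cover])
  have "integral {0..1} R \<le> (\<Sum>i<n. integral {t i..t (Suc i)} K + (P i - Q i))"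
    unfolding totR(2) using piece(3) by (intro sum_mono) (simp add: algebra_simps)
  also have "\<dots> = integral {0..1} K + (\<Sum>i<n. P i - Q i)"
    unfolding totK(2) sum.distrib ..
  also have "\<dots> \<le> total_curvature \<gamma> + pi"
    using sum[of m] Q0 unfolding turn m by simp
  finally show "integral {0..1} (\<lambda>t. \<bar>Im (velocity \<gamma> t / (\<gamma> t - z))\<bar>) \<le> total_curvature \<gamma> + pi"
    unfolding R_def[abs_def] .
  show "(\<lambda>t. \<bar>Im (velocity \<gamma> t / (\<gamma> t - z))\<bar>) integrable_on {0..1}"
    using totR(1) unfolding R_def[abs_def] .
  have "0 \<le> integral {0..1} K"
    using totK(1) by (rule integral_nonneg) (auto simp: K_def abs_curvature_def)
  moreover have "0 \<le> (\<Sum>i\<in>{1..<n}. turning_angle \<gamma> (t i))"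
    by (intro sum_nonneg) (simp add: turning_angle_def)
  ultimately show "0 \<le> total_curvature \<gamma>" unfolding turn by simp
qed

lemma total_curvature_nonneg:
  assumes "piecewise_smooth \<gamma>" shows "0 \<le> total_curvature \<gamma>"
proof -
  have "bounded (path_image \<gamma>)"
    using assms by (intro bounded_path_image) (simp add: piecewise_smooth_def)
  hence "path_image \<gamma> \<noteq> UNIV" using not_bounded_UNIV[where 'a = complex] by auto
  thus ?thesis using rotation_le_total_curvature(3)[OF assms] by auto
qed

section \<open>The variation of the argument as an integral\<close>

text \<open>The imaginary part of the integral of \<open>(f \<circ> \<gamma>)'/(f \<circ> \<gamma>)\<close> is a continuous branch of the argument, because
  \<open>f \<circ> \<gamma>\<close> is a path that avoids 0.\<close>

lemma arg_variation_le_integral: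
  assumes vp: "valid_path \<gamma>" and holf: "f holomorphic_on U" and U: "open U" "path_image \<gamma> \<subseteq> U"
    and nz: "\<And>z. z \<in> path_image \<gamma> \<Longrightarrow> f z \<noteq> 0"
    and h: "h integrable_on {0..1}" and T: "finite T"
    and deriv: "\<And>t. t \<in> {0..1} - T \<Longrightarrow> (\<gamma> has_vector_derivative \<gamma>' t) (at t)"
    and bound: "\<And>t. t \<in> {0..1} - T \<Longrightarrow> \<bar>Im (\<gamma>' t * (deriv f (\<gamma> t) / f (\<gamma> t)))\<bar> \<le> h t"
  shows "arg_variation f \<gamma> \<le> ereal (integral {0..1} h)"
proof -
  define g where "g = f \<circ> \<gamma>"
  have vg: "valid_path g" unfolding g_def using vp holf U by (rule valid_path_compose_holomorphic)
  have g0: "g t \<noteq> 0" if "t \<in> {0..1}" for t using nz that by (auto simp: g_def path_image_def)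
  define I where "I t = vector_derivative g (at t) / (g t - 0)" for t
  define E where "E t = integral {0..t} I" for t
  have PC: "g piecewise_C1_differentiable_on {0..t}" if "t \<in> {0..1}" for t
    using vg unfolding valid_path_def by (rule piecewise_C1_differentiable_on_subset) (use that in auto)
  have int: "I integrable_on {0..t}" and gE: "g t = g 0 * exp (E t)" if t: "t \<in> {0..1}" for t
  proof -
    have z: "0 \<notin> g ` {0..t}" using g0 t by force
    show "I integrable_on {0..t}"
      unfolding I_def[abs_def] using winding_number_exp_integral(1)[OF PC[OF t] _ z] t by auto
    have "exp (- E t) * (g t - 0) = g 0 - 0"
      unfolding E_def I_def[abs_def] using winding_number_exp_integral(2)[OF PC[OF t] _ z] t by auto
    thus "g t = g 0 * exp (E t)" by (simp add: exp_minus field_simps)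
  qed
  define \<phi> where "\<phi> t = Arg (g 0) + Im (E t)" for t
  have "is_arg_branch f \<gamma> \<phi>"
    unfolding is_arg_branch_def
  proof (intro conjI ballI)
    have "continuous_on {0..1} E"
      unfolding E_def using int[of 1] by (intro indefinite_integral_continuous_1) auto
    thus "continuous_on {0..1} \<phi>" unfolding \<phi>_def by (intro continuous_intros)
    fix t :: real assume t: "t \<in> {0..1}"
    have "g 0 * exp (E t) = (of_real (norm (g 0)) * cis (Arg (g 0))) * (of_real (norm (exp (E t))) * cis (Im (E t)))"
      using rcis_cmod_Arg[of "g 0"] by (simp add: rcis_def exp_eq_polar[of "E t"] norm_mult)
    also have "\<dots> = of_real (norm (g 0) * norm (exp (E t))) * (cis (Arg (g 0)) * cis (Im (E t)))"
      by (simp only: of_real_mult mult_ac)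
    also have "\<dots> = of_real (norm (g 0 * exp (E t))) * cis (\<phi> t)"
      by (simp only: norm_mult cis_mult \<phi>_def)
    finally show "f (\<gamma> t) = of_real (norm (f (\<gamma> t))) * cis (\<phi> t)"
      unfolding gE[OF t, symmetric] by (simp add: g_def)
  qed
  hence eq: "arg_variation f \<gamma> = total_variation \<phi>"
    using nz by (intro arg_variation_eq) auto
  \<comment> \<open>The exceptional parameters are handled by a change of the bound on a finite set.\<close>
  define h' where "h' t = (if t \<in> T then \<bar>Im (I t)\<bar> else h t)" for t
  have neg: "negligible T" using T by (rule negligible_finite)
  have h': "h' integrable_on {0..1}" "integral {0..1} h' = integral {0..1} h"
    using integrable_spike[OF h neg, of h'] integral_spike[OF neg, of "{0..1}" h h'] by (auto simp: h'_def)
  have Ibound: "norm (Im (I t)) \<le> h' t" if t: "t \<in> {0..1}" for t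
  proof (cases "t \<in> T")
    case False
    hence t': "t \<in> {0..1} - T" using t by auto
    have "\<gamma> t \<in> U" using U(2) t by (auto simp: path_image_def)
    hence "(f has_field_derivative deriv f (\<gamma> t)) (at (\<gamma> t))"
      using holf U(1) by (simp add: holomorphic_derivI)
    from field_vector_diff_chain_at[OF deriv[OF t'] this]
    have "vector_derivative g (at t) = \<gamma>' t * deriv f (\<gamma> t)"
      unfolding g_def by (rule vector_derivative_at)
    hence "I t = \<gamma>' t * (deriv f (\<gamma> t) / f (\<gamma> t))" by (simp add: I_def g_def)
    thus ?thesis using bound[OF t'] False by (simp add: h'_def)
  qed (simp add: h'_def)
  have "total_variation \<phi> \<le> ereal (integral {0..1} h' - integral {0..0} h')"
  proof (rule total_variation_le_increment)
    fix s u :: real assume su: "0 \<le> s" "s \<le> u" "u \<le> 1"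
    have Isu: "I integrable_on {s..u}" using int[of 1] su by (auto intro: integrable_on_subinterval)
    have hsu: "h' integrable_on {s..u}" using h'(1) su by (auto intro: integrable_on_subinterval)
    have "\<phi> u - \<phi> s = Im (E u - E s)" by (simp add: \<phi>_def)
    also have "E u - E s = integral {s..u} I"
      using Henstock_Kurzweil_Integration.integral_combine[OF su(1,2) int[of u]] su by (simp add: E_def algebra_simps)
    also have "Im (integral {s..u} I) = integral {s..u} (\<lambda>t. Im (I t))"
      using integral_linear[OF Isu bounded_linear_Im] by (simp add: o_def)
    finally have "norm (\<phi> u - \<phi> s) \<le> integral {s..u} h'"
      using integral_norm_bound_integral[of "\<lambda>t. Im (I t)" "{s..u}" h'] hsu Ibound su
        integrable_linear[OF Isu bounded_linear_Im] by (auto simp: o_def)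
    moreover have "integral {0..s} h' + integral {s..u} h' = integral {0..u} h'"
      using h'(1) su by (intro Henstock_Kurzweil_Integration.integral_combine) (auto intro: integrable_on_subinterval)
    ultimately show "dist (\<phi> s) (\<phi> u) \<le> integral {0..u} h' - integral {0..s} h'"
      by (simp add: dist_real_def)
  qed
  thus ?thesis unfolding eq by (simp add: h'(2))
qed

section \<open>Zeros and logarithmic derivatives\<close>

text \<open>The point \<open>a\<close> need not be a zero; the exponent is then 0.\<close>

lemma holomorphic_factor_out_point:
  assumes holf: "f holomorphic_on U" and U: "open U" "connected U" and nz: "\<exists>w\<in>U. f w \<noteq> 0"
    and a: "a \<in> U"
  shows "\<exists>k g. g holomorphic_on U \<and> (\<forall>z\<in>U. f z = (z - a) ^ k * g z) \<and> g a \<noteq> 0"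
proof -
  define k where "k = nat (zorder f a)"
  obtain r where r: "r > 0" "cball a r \<subseteq> U" "zor_poly f a holomorphic_on cball a r"
      "\<And>w. w \<in> cball a r \<Longrightarrow> f w = zor_poly f a w * (w - a) ^ k \<and> zor_poly f a w \<noteq> 0"
    using zorder_exist_zero[OF holf U a nz] unfolding k_def by blast
  define g where "g z = (if z = a then zor_poly f a a else f z / (z - a) ^ k)" for z
  have geq: "g z = zor_poly f a z" if "z \<in> ball a r" for z
    using r(4)[of z] that by (auto simp: g_def)
  have "g holomorphic_on ball a r"
    using holomorphic_cong[OF refl geq] r(3) by (meson ball_subset_cball holomorphic_on_subset)
  moreover have "g holomorphic_on U - {a}"
  proof (rule holomorphic_transform)
    show "(\<lambda>z. f z / (z - a) ^ k) holomorphic_on U - {a}"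
      using holf by (auto intro!: holomorphic_intros intro: holomorphic_on_subset)
  qed (auto simp: g_def)
  ultimately have "g holomorphic_on ball a r \<union> (U - {a})"
    using U by (intro holomorphic_on_Un) auto
  moreover have "ball a r \<union> (U - {a}) = U" using r a by auto
  moreover have "f z = (z - a) ^ k * g z" if "z \<in> U" for z
    using r(4)[of a] r(1) by (cases "z = a") (auto simp: g_def)
  moreover have "g a \<noteq> 0" using r(4)[of a] r(1) by (simp add: g_def)
  ultimately show ?thesis by auto
qed

lemma holomorphic_factor_out_finite:
  assumes holf: "f holomorphic_on U" and U: "open U" "connected U" and nz: "\<exists>w\<in>U. f w \<noteq> 0"
    and A: "finite A" "A \<subseteq> U"
  shows "\<exists>(n::complex \<Rightarrow> nat) g. g holomorphic_on U \<and>
           (\<forall>z\<in>U. f z = (\<Prod>a\<in>A. (z - a) ^ n a) * g z) \<and> (\<forall>a\<in>A. g a \<noteq> 0)"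
  using A
proof (induction A)
  case empty
  show ?case using holf by auto
next
  case (insert b A)
  then obtain n g where g: "g holomorphic_on U" "\<And>a. a \<in> A \<Longrightarrow> g a \<noteq> 0"
      "\<And>z. z \<in> U \<Longrightarrow> f z = (\<Prod>a\<in>A. (z - a) ^ n a) * g z"
    by (metis insert_subset)
  have "\<exists>w\<in>U. g w \<noteq> 0" using nz g(3) by fastforce
  then obtain k h where h: "h holomorphic_on U" "h b \<noteq> 0" "\<And>z. z \<in> U \<Longrightarrow> g z = (z - b) ^ k * h z"
    using holomorphic_factor_out_point[OF g(1) U, of b] insert.prems by auto
  have "(\<Prod>a\<in>A. (z - a) ^ (n(b := k)) a) = (\<Prod>a\<in>A. (z - a) ^ n a)" for z
    using insert.hyps by (intro prod.cong) auto
  hence "f z = (\<Prod>a\<in>insert b A. (z - a) ^ (n(b := k)) a) * h z" if "z \<in> U" for z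
    using insert.hyps g(3)[OF that] h(3)[OF that] by simp
  moreover have "h a \<noteq> 0" if "a \<in> insert b A" for a
    using that g(2)[of a] h(3)[of a] h(2) insert.prems by auto
  ultimately show ?case using h(1) by blast
qed

text \<open>Jensen's inequality in a crude form.  On the circle of radius \<open>3 \<rho>\<close> every factor \<open>\<bar>w - a\<bar>\<close> is at least
  \<open>2 \<rho>\<close>, whereas at the centre it is at most \<open>\<rho>\<close>.  By the maximum principle each zero in the disc of radius \<open>\<rho>\<close>
  costs a factor 2 in the comparison of \<open>f\<close> with its value at the centre, and the ratio
  of the bound for the quotient \<open>G\<close> to its value at the centre is no worse than the same ratio for \<open>f\<close>.\<close>

lemma zeros_local_bound:
  fixes n :: "complex \<Rightarrow> nat"
  assumes holG: "G holomorphic_on cball q (3 * \<rho>)" and A: "finite A" "A \<subseteq> cball q \<rho>"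
    and f: "\<And>w. w \<in> cball q (3 * \<rho>) \<Longrightarrow> f w = (\<Prod>a\<in>A. (w - a) ^ n a) * G w"
    and up: "\<And>w. w \<in> cball q (3 * \<rho>) \<Longrightarrow> norm (f w) \<le> M" and low: "M * exp (- \<Lambda>) \<le> norm (f q)"
    and M: "0 < M" and \<rho>: "0 < \<rho>"
  shows "real (\<Sum>a\<in>A. n a) * ln 2 \<le> \<Lambda>"
    and "\<exists>S. (\<forall>w\<in>cball q (3 * \<rho>). norm (G w) \<le> S) \<and> S * exp (- \<Lambda>) \<le> norm (G q)"
proof -
  define N where "N = (\<Sum>a\<in>A. n a)"
  define S where "S = M / (2 * \<rho>) ^ N"
  have prod_const: "(\<Prod>a\<in>A. c ^ n a) = c ^ N" for c :: real
    using A(1) unfolding N_def by (induction A) (auto simp: power_add)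
  have G_le: "norm (G w) \<le> S" if w: "w \<in> cball q (3 * \<rho>)" for w
  proof (rule maximum_modulus_frontier[where f = G and S = "cball q (3 * \<rho>)"])
    show "G holomorphic_on interior (cball q (3 * \<rho>))" using holG
      by (meson holomorphic_on_subset interior_subset)
    show "continuous_on (closure (cball q (3 * \<rho>))) G"
      using holG by (simp add: holomorphic_on_imp_continuous_on)
    fix v assume "v \<in> frontier (cball q (3 * \<rho>))"
    hence v: "dist q v = 3 * \<rho>" using \<rho> by (simp add: frontier_cball)
    have "(2 * \<rho>) ^ N \<le> (\<Prod>a\<in>A. norm (v - a) ^ n a)"
      unfolding prod_const[symmetric]
    proof (intro prod_mono conjI power_mono)
      fix a assume "a \<in> A"
      hence "dist q a \<le> \<rho>" using A(2) by auto
      thus "2 * \<rho> \<le> norm (v - a)"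
        using dist_triangle[of q v a] v by (simp add: dist_norm norm_minus_commute)
    qed (use \<rho> in auto)
    moreover have "(\<Prod>a\<in>A. norm (v - a) ^ n a) * norm (G v) \<le> M"
      using up[of v] f[of v] v by (simp add: norm_mult prod_norm[symmetric] norm_power)
    ultimately have "(2 * \<rho>) ^ N * norm (G v) \<le> M"
      by (meson mult_right_mono norm_ge_zero order_trans)
    thus "norm (G v) \<le> S" using \<rho> by (simp add: S_def field_simps)
  qed (use w in auto)
  have "(\<Prod>a\<in>A. norm (q - a) ^ n a) \<le> \<rho> ^ N"
    unfolding prod_const[symmetric] using A(2) by (intro prod_mono conjI power_mono) (auto simp: dist_norm)
  moreover have "M * exp (- \<Lambda>) \<le> (\<Prod>a\<in>A. norm (q - a) ^ n a) * norm (G q)"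
    using low f[of q] \<rho> by (simp add: norm_mult prod_norm[symmetric] norm_power)
  ultimately have Gq: "M * exp (- \<Lambda>) \<le> \<rho> ^ N * norm (G q)"
    by (meson mult_right_mono norm_ge_zero order_trans)
  also have "\<dots> \<le> \<rho> ^ N * S" using G_le[of q] \<rho> by (intro mult_left_mono) auto
  also have "\<dots> = M / 2 ^ N" using \<rho> by (simp add: S_def power_mult_distrib)
  finally have "2 ^ N \<le> exp \<Lambda>" using M by (simp add: field_simps exp_minus)
  hence "ln (2 ^ N) \<le> ln (exp \<Lambda>)" by (subst ln_le_cancel_iff) auto
  thus "real (\<Sum>a\<in>A. n a) * ln 2 \<le> \<Lambda>" by (simp add: ln_realpow N_def)
  have "S * exp (- \<Lambda>) \<le> norm (G q)"
  proof -
    have "\<rho> ^ N * norm (G q) \<le> (2 * \<rho>) ^ N * norm (G q)"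
      using \<rho> by (intro mult_right_mono power_mono) auto
    with Gq have "M * exp (- \<Lambda>) \<le> (2 * \<rho>) ^ N * norm (G q)" by linarith
    thus ?thesis using \<rho> by (simp add: S_def field_simps)
  qed
  with G_le show "\<exists>S. (\<forall>w\<in>cball q (3 * \<rho>). norm (G w) \<le> S) \<and> S * exp (- \<Lambda>) \<le> norm (G q)"
    by blast
qed

text \<open>The Borel-Caratheodory inequality: \<open>k\<close> followed by the Cayley transform of the right half plane onto the
  disc that sends \<open>k 0\<close> to 0 is a self-map of the disc to which Schwarz's lemma applies.\<close>

lemma positive_real_part_growth:
  assumes holk: "k holomorphic_on ball 0 1" and pos: "\<And>w. w \<in> ball 0 1 \<Longrightarrow> 0 < Re (k w)"
    and w: "norm w < 1"
  shows "norm (k w - k 0) * (1 - norm w) \<le> 2 * Re (k 0) * norm w"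
proof -
  define \<phi> where "\<phi> w = (k w - k 0) / (k w + cnj (k 0))" for w
  have den: "k w + cnj (k 0) \<noteq> 0" if "w \<in> ball 0 1" for w
  proof
    assume "k w + cnj (k 0) = 0"
    hence "Re (k w + cnj (k 0)) = 0" by simp
    thus False using pos[OF that] pos[of 0] by simp
  qed
  have lt: "norm (\<phi> w) < 1" if "w \<in> ball 0 1" for w
  proof -
    have "(norm (k w - k 0))\<^sup>2 = (norm (k w + cnj (k 0)))\<^sup>2 - 4 * Re (k w) * Re (k 0)"
      unfolding cmod_power2 by (simp add: power2_eq_square algebra_simps)
    moreover have "0 < Re (k w) * Re (k 0)" using pos[OF that] pos[of 0] by simp
    ultimately have "(norm (k w - k 0))\<^sup>2 < (norm (k w + cnj (k 0)))\<^sup>2" by linarith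
    hence "norm (k w - k 0) < norm (k w + cnj (k 0))" by (simp add: power_less_imp_less_base)
    thus ?thesis using den[OF that] by (simp add: \<phi>_def norm_divide)
  qed
  have "norm (\<phi> w) \<le> norm w"
  proof (rule Schwarz_Lemma(1))
    show "\<phi> holomorphic_on ball 0 1" unfolding \<phi>_def
      using holk den by (auto intro!: holomorphic_intros)
  qed (use lt w in \<open>auto simp: \<phi>_def\<close>)
  have "k w - k 0 = \<phi> w * ((k w - k 0) + of_real (2 * Re (k 0)))"
  proof -
    have "(k w - k 0) + of_real (2 * Re (k 0)) = k w + cnj (k 0)"
      by (simp add: complex_eq_iff)
    thus ?thesis unfolding \<phi>_def using den[of w] w by (metis nonzero_divide_eq_eq mem_ball_0)
  qed
  hence "norm (k w - k 0) = norm (\<phi> w) * norm ((k w - k 0) + of_real (2 * Re (k 0)))"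
    by (metis norm_mult)
  also have "\<dots> \<le> norm w * (norm (k w - k 0) + 2 * Re (k 0))"
    using pos[of 0] \<open>norm (\<phi> w) \<le> norm w\<close>
    by (intro mult_mono' order_trans[OF norm_triangle_ineq]) auto
  finally show ?thesis by (simp add: algebra_simps)
qed

text \<open>A branch \<open>h\<close> of the logarithm of \<open>G\<close> has real part at most \<open>ln S\<close>, and at least \<open>ln S - \<Lambda>\<close> at the
  centre, so \<open>ln S + \<Lambda> - h\<close> has positive real part, at most \<open>2 \<Lambda>\<close> at the centre.  The
  growth bound keeps its oscillation below \<open>16 \<Lambda>\<close> on four fifths of the disc, and Cauchy's
  inequality on a disc of two fifths of the radius bounds the derivative of \<open>h\<close>.\<close>

lemma zero_free_logderiv_bound:
  assumes holG: "G holomorphic_on ball q \<rho>" and nz: "\<And>w. w \<in> ball q \<rho> \<Longrightarrow> G w \<noteq> 0"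
    and up: "\<And>w. w \<in> ball q \<rho> \<Longrightarrow> norm (G w) \<le> S" and low: "S * exp (- \<Lambda>) \<le> norm (G q)"
    and \<Lambda>: "0 < \<Lambda>" and \<rho>: "0 < \<rho>" and z: "dist q z \<le> 2/5 * \<rho>"
  shows "norm (deriv G z / G z) \<le> 40 * \<Lambda> / \<rho>"
proof -
  obtain h where h: "h holomorphic_on ball q \<rho>" "\<And>w. w \<in> ball q \<rho> \<Longrightarrow> G w = exp (h w)"
    using contractible_imp_holomorphic_log[OF holG convex_imp_contractible nz] by auto
  have S: "0 < S" using up[of q] nz[of q] \<rho> by (auto intro: less_le_trans[of 0 "norm (G q)"])
  have Re_h: "Re (h w) \<le> ln S" if "w \<in> ball q \<rho>" for w
    using up[OF that] S by (simp add: h(2)[OF that] ln_ge_iff)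
  have Re_hq: "ln S - \<Lambda> \<le> Re (h q)"
  proof -
    have "exp (ln S - \<Lambda>) \<le> exp (Re (h q))"
      using low S h(2)[of q] \<rho> by (simp add: exp_diff exp_minus field_simps)
    thus ?thesis by simp
  qed
  define k where "k w = of_real (ln S + \<Lambda>) - h (q + of_real \<rho> * w)" for w
  have inb: "q + of_real \<rho> * w \<in> ball q \<rho>" if "w \<in> ball 0 1" for w
    using that \<rho> by (auto simp: dist_norm norm_mult)
  have holk: "k holomorphic_on ball 0 1"
  proof -
    have "(h \<circ> (\<lambda>w. q + of_real \<rho> * w)) holomorphic_on ball 0 1"
      by (rule holomorphic_on_compose_gen[OF _ h(1)]) (auto intro!: holomorphic_intros inb)
    thus ?thesis unfolding k_def o_def by (intro holomorphic_intros) auto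
  qed
  have pos: "0 < Re (k w)" if "w \<in> ball 0 1" for w
    using Re_h[OF inb[OF that]] \<Lambda> by (simp add: k_def)
  have k0: "Re (k 0) \<le> 2 * \<Lambda>" using Re_hq by (simp add: k_def)
  have bd: "norm (k w - k 0) \<le> 16 * \<Lambda>" if "norm w \<le> 4/5" for w
  proof -
    have "norm (k w - k 0) * (1/5) \<le> norm (k w - k 0) * (1 - norm w)"
      using that by (intro mult_left_mono) auto
    also have "\<dots> \<le> 2 * Re (k 0) * norm w"
      using that by (intro positive_real_part_growth holk pos) auto
    also have "\<dots> \<le> (2 * (2 * \<Lambda>)) * (4/5)"
      using that k0 \<Lambda> pos[of 0] by (intro mult_mono) auto
    finally show ?thesis by simp
  qed
  \<comment> \<open>\<open>z\<close> in the coordinate of the unit disc\<close>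
  define w where "w = (z - q) / of_real \<rho>"
  have w: "norm w \<le> 2/5"
    using z \<rho> by (simp add: w_def norm_divide dist_norm norm_minus_commute field_simps)
  have zw: "z = q + of_real \<rho> * w" using \<rho> by (simp add: w_def)
  have zin: "z \<in> ball q \<rho>" using z \<rho> by auto
  have cb: "cball w (2/5) \<subseteq> ball 0 1" "\<And>x. x \<in> cball w (2/5) \<Longrightarrow> norm x \<le> 4/5"
  proof -
    show *: "norm x \<le> 4/5" if "x \<in> cball w (2/5)" for x
    proof -
      have "norm x \<le> norm w + norm (x - w)" by (metis add.commute diff_add_cancel norm_triangle_ineq)
      thus ?thesis using that w by (auto simp: dist_norm norm_minus_commute)
    qed
    show "cball w (2/5) \<subseteq> ball 0 1"
    proof
      fix x assume "x \<in> cball w (2/5)"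
      from *[OF this] show "x \<in> ball 0 1" by simp
    qed
  qed
  have "norm ((deriv ^^ 1) (\<lambda>x. k x - k 0) w) \<le> fact 1 * (16 * \<Lambda>) / (2/5) ^ 1"
  proof (rule Cauchy_inequality)
    show hol: "(\<lambda>x. k x - k 0) holomorphic_on ball w (2/5)"
      using cb(1) ball_subset_cball[of w "2/5"] holk
      by (intro holomorphic_intros) (meson holomorphic_on_subset order_trans)
    show "continuous_on (cball w (2/5)) (\<lambda>x. k x - k 0)"
      using cb(1) holk
      by (intro continuous_intros holomorphic_on_imp_continuous_on) (meson holomorphic_on_subset)
    show "norm (k x - k 0) \<le> 16 * \<Lambda>" if "norm (w - x) = 2/5" for x
      using that by (intro bd cb(2)) (auto simp: dist_norm)
  qed auto
  moreover have "deriv (\<lambda>x. k x - k 0) w = - of_real \<rho> * deriv h z"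
  proof (rule DERIV_imp_deriv)
    have "(h has_field_derivative deriv h z) (at (q + of_real \<rho> * w))"
      using h(1) zin zw by (metis holomorphic_derivI open_ball)
    hence "((\<lambda>x. h (q + of_real \<rho> * x)) has_field_derivative deriv h z * of_real \<rho>) (at w)"
      by (rule DERIV_chain2) (auto intro!: derivative_eq_intros)
    thus "((\<lambda>x. k x - k 0) has_field_derivative - of_real \<rho> * deriv h z) (at w)"
      unfolding k_def by (auto intro!: derivative_eq_intros)
  qed
  ultimately have "\<rho> * norm (deriv h z) \<le> 40 * \<Lambda>"
    using \<rho> by (simp add: norm_mult)
  moreover have "deriv G z / G z = deriv h z"
  proof -
    have "(h has_field_derivative deriv h z) (at z)"
      using h(1) zin by (metis holomorphic_derivI open_ball)
    hence "((\<lambda>w. exp (h w)) has_field_derivative exp (h z) * deriv h z) (at z)"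
      by (auto intro!: derivative_eq_intros)
    hence "(G has_field_derivative exp (h z) * deriv h z) (at z)"
      by (rule has_field_derivative_transform_within_open[OF _ open_ball zin]) (simp add: h(2))
    thus ?thesis using h(2)[OF zin] by (simp add: DERIV_imp_deriv)
  qed
  ultimately show ?thesis using \<rho> by (simp add: field_simps)
qed

lemma logderiv_near_zeros:
  fixes n :: "complex \<Rightarrow> nat"
  assumes A: "finite A" and G: "(G has_field_derivative G') (at z)" "G z \<noteq> 0" and z: "z \<notin> A"
    and U: "open U" "z \<in> U" "\<And>w. w \<in> U \<Longrightarrow> f w = (\<Prod>a\<in>A. (w - a) ^ n a) * G w"
  shows "deriv f z / f z = (\<Sum>a\<in>A. of_nat (n a) / (z - a)) + G' / G z"
proof -
  define P where "P w = (\<Prod>a\<in>A. (w - a) ^ n a)" for w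
  have za: "z - a \<noteq> 0" if "a \<in> A" for a using that z by auto
  have Pz: "P z \<noteq> 0" using za A by (simp add: P_def)
  have "(P has_field_derivative P z * (\<Sum>a\<in>A. (of_nat (n a) * (z - a) ^ (n a - 1)) / (z - a) ^ n a)) (at z)"
    unfolding P_def using za by (intro has_field_derivative_prod') (auto intro!: derivative_eq_intros)
  also have "(\<Sum>a\<in>A. (of_nat (n a) * (z - a) ^ (n a - 1)) / (z - a) ^ n a) = (\<Sum>a\<in>A. of_nat (n a) / (z - a))"
  proof (rule sum.cong[OF refl])
    fix a assume a: "a \<in> A"
    show "(of_nat (n a) * (z - a) ^ (n a - 1)) / (z - a) ^ n a = of_nat (n a) / (z - a)"
      using za[OF a] by (cases "n a") auto
  qed
  finally have "((\<lambda>w. P w * G w) has_field_derivative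
      P z * (\<Sum>a\<in>A. of_nat (n a) / (z - a)) * G z + G' * P z) (at z)"
    using G(1) by (rule DERIV_mult)
  hence "(f has_field_derivative
      P z * (\<Sum>a\<in>A. of_nat (n a) / (z - a)) * G z + G' * P z) (at z)"
    by (rule has_field_derivative_transform_within_open[OF _ U(1,2)]) (simp add: U(3) P_def)
  hence "deriv f z = P z * (\<Sum>a\<in>A. of_nat (n a) / (z - a)) * G z + G' * P z" by (rule DERIV_imp_deriv)
  moreover have "f z = P z * G z" using U(2,3) by (simp add: P_def)
  ultimately show ?thesis using Pz G(2) by (simp add: field_simps)
qed

section \<open>Propagation of lower bounds\<close>

text \<open>Hadamard's three circles theorem for the radii \<open>s\<close>, \<open>k s\<close>, \<open>k\<^sup>2 s\<close>, with a direct proof.  For \<open>p = z + d\<close>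
  the product \<open>f (z + w) f (z + d\<^sup>2/w)\<close> is holomorphic on the annulus which the inversion \<open>w \<mapsto> d\<^sup>2/w\<close> maps to
  itself.  On either boundary circle one factor is bounded by the maximum of \<open>\<bar>f\<bar>\<close> on the small disc and
  the other by \<open>M\<close>; at \<open>w = d\<close> the product is \<open>f(p)\<^sup>2\<close>.\<close>

lemma three_circles_geometric_mean:
  fixes f :: "complex \<Rightarrow> complex"
  assumes holf: "f holomorphic_on cball z (k\<^sup>2 * s)" and s: "0 < s"
    and bd: "\<And>w. w \<in> cball z (k\<^sup>2 * s) \<Longrightarrow> norm (f w) \<le> M"
    and p: "dist z p \<le> k * s" and k: "1 \<le> k"
  obtains q where "dist z q \<le> s" "(norm (f p))\<^sup>2 \<le> M * norm (f q)"
proof (cases "dist z p \<le> s")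
  case True
  have "s \<le> k\<^sup>2 * s" using s k by (simp add: one_le_power)
  hence "norm (f p) \<le> M" using True by (intro bd) auto
  hence "(norm (f p))\<^sup>2 \<le> M * norm (f p)"
    by (simp add: power2_eq_square mult_right_mono)
  with True that show ?thesis by blast
next
  case False
  define d where "d = p - z"
  define c where "c = norm d"
  have c: "s < c" "c \<le> k * s"
    using False p by (auto simp: c_def d_def dist_norm norm_minus_commute)
  define R where "R = c\<^sup>2 / s"
  have R: "R \<le> k\<^sup>2 * s"
  proof -
    have "c\<^sup>2 \<le> (k * s)\<^sup>2" using c s by (intro power_mono) auto
    thus ?thesis using s by (simp add: R_def field_simps power2_eq_square)
  qed
  have cR: "c < R"
    using c s by (simp add: R_def power2_eq_square field_simps)
  have ks: "s \<le> k\<^sup>2 * s" using s k by (simp add: one_le_power)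
  have "continuous_on (cball z s) (\<lambda>w. norm (f w))"
    using holf ks by (intro continuous_on_norm holomorphic_on_imp_continuous_on)
       (auto intro: holomorphic_on_subset)
  then obtain q where q: "q \<in> cball z s" "\<And>w. w \<in> cball z s \<Longrightarrow> norm (f w) \<le> norm (f q)"
    using continuous_attains_sup[of "cball z s" "\<lambda>w. norm (f w)"] s by auto
  define h where "h w = f (z + w) * f (z + d\<^sup>2 / w)" for w
  define S where "S = {w::complex. s < norm w \<and> norm w < R}"
  have Seq: "S = ball 0 R \<inter> - cball 0 s" by (auto simp: S_def)
  have opS: "open S" unfolding Seq by auto
  define T where "T = {w::complex. s \<le> norm w \<and> norm w \<le> R}"
  have clT: "closed T"
  proof -
    have "T = cball 0 R \<inter> - ball 0 s" by (auto simp: T_def)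
    thus ?thesis by auto
  qed
  have inv: "norm (d\<^sup>2 / w) = c\<^sup>2 / norm w" for w
    by (simp add: norm_divide norm_power c_def)
  have inT: "z + w \<in> cball z (k\<^sup>2 * s)" "z + d\<^sup>2 / w \<in> cball z (k\<^sup>2 * s)" "w \<noteq> 0" if "w \<in> T" for w
  proof -
    show w0: "w \<noteq> 0" using that s by (auto simp: T_def)
    show "z + w \<in> cball z (k\<^sup>2 * s)" using that R by (auto simp: T_def dist_norm)
    have "c\<^sup>2 / norm w \<le> c\<^sup>2 / s"
      using that s w0 by (intro divide_left_mono) (auto simp: T_def)
    thus "z + d\<^sup>2 / w \<in> cball z (k\<^sup>2 * s)" using inv[of w] R by (auto simp: dist_norm R_def)
  qed
  have holh: "h holomorphic_on T"
  proof -
    have "(f \<circ> (\<lambda>w. z + w)) holomorphic_on T"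
      by (rule holomorphic_on_compose_gen[OF _ holf]) (auto intro!: holomorphic_intros inT)
    moreover have "(f \<circ> (\<lambda>w. z + d\<^sup>2 / w)) holomorphic_on T"
      by (rule holomorphic_on_compose_gen[OF _ holf]) (use inT in \<open>auto intro!: holomorphic_intros\<close>)
    ultimately show ?thesis unfolding h_def o_def by (rule holomorphic_on_mult)
  qed
  have ST: "S \<subseteq> T" by (auto simp: S_def T_def)
  have clST: "closure S \<subseteq> T" using ST clT by (simp add: closure_minimal)
  have bdy: "norm (h w) \<le> M * norm (f q)" if "w \<in> frontier S" for w
  proof -
    have "w \<in> T" using that clST by (auto simp: frontier_def)
    moreover have "w \<notin> S" using that opS by (simp add: frontier_def interior_open)
    ultimately have "norm w = s \<or> norm w = R" by (auto simp: S_def T_def)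
    thus ?thesis
    proof
      assume w: "norm w = s"
      have "norm (f (z + w)) \<le> norm (f q)" using w by (intro q(2)) (auto simp: dist_norm)
      moreover have "norm (f (z + d\<^sup>2 / w)) \<le> M" using inT[OF \<open>w \<in> T\<close>] by (intro bd) auto
      ultimately show ?thesis
        unfolding h_def norm_mult by (subst mult.commute) (intro mult_mono', auto)
    next
      assume w: "norm w = R"
      have "c\<^sup>2 / R = s" using cR s c by (simp add: R_def)
      hence "norm (f (z + d\<^sup>2 / w)) \<le> norm (f q)"
        using w inv[of w] by (intro q(2)) (auto simp: dist_norm)
      moreover have "norm (f (z + w)) \<le> M" using inT[OF \<open>w \<in> T\<close>] by (intro bd) auto
      ultimately show ?thesis unfolding h_def norm_mult by (intro mult_mono') auto
    qed
  qed
  have "norm (h d) \<le> M * norm (f q)"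
  proof (rule maximum_modulus_frontier[where f = h and S = S])
    show "h holomorphic_on interior S" using holh ST opS by (metis holomorphic_on_subset interior_open)
    show "continuous_on (closure S) h"
      using holh clST by (meson holomorphic_on_imp_continuous_on continuous_on_subset)
    show "bounded S" by (rule bounded_subset[of "ball 0 R"]) (auto simp: S_def)
    show "d \<in> S" using c cR by (auto simp: S_def c_def)
  qed (use bdy in auto)
  moreover have "norm (h d) = (norm (f p))\<^sup>2"
    using c s by (auto simp: h_def d_def norm_mult power2_eq_square c_def)
  ultimately show ?thesis using q(1) that[of q] by (auto simp: dist_commute)
qed

text \<open>One step: a point within \<open>s\<close> of a centre is within \<open>3 s\<close> of the next centre, so
  the three circles theorem with ratio 3 finds a point within \<open>s\<close> of the next centre, at the price of doubling
  the exponent.\<close>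

lemma lower_bound_propagates_along_chain:
  fixes f :: "complex \<Rightarrow> complex"
  assumes holf: "f holomorphic_on W" and bd: "\<And>w. w \<in> W \<Longrightarrow> norm (f w) \<le> M" and M: "0 < M" and s: "0 < s"
    and W: "\<And>i. cball (x i) (9 * s) \<subseteq> W"
    and step: "\<And>i. i < n \<Longrightarrow> dist (x i) (x (Suc i)) \<le> 2 * s"
    and p: "dist (x 0) p \<le> s" "M * exp (- b) \<le> norm (f p)"
  shows "\<exists>q. dist (x n) q \<le> s \<and> M * exp (- (2 ^ n * b)) \<le> norm (f q)"
  using step
proof (induction n)
  case 0
  show ?case using p by auto
next
  case (Suc n)
  then obtain q where q: "dist (x n) q \<le> s" "M * exp (- (2 ^ n * b)) \<le> norm (f q)" by auto
  have "dist (x (Suc n)) q \<le> 3 * s"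
    using dist_triangle[of "x (Suc n)" q "x n"] q(1) Suc.prems[of n] by (simp add: dist_commute)
  moreover have "f holomorphic_on cball (x (Suc n)) (3\<^sup>2 * s)"
    using holf by (rule holomorphic_on_subset) (use W[of "Suc n"] in simp)
  moreover have "norm (f w) \<le> M" if "w \<in> cball (x (Suc n)) (3\<^sup>2 * s)" for w
    using that W[of "Suc n"] by (intro bd) auto
  ultimately obtain q' where q': "dist (x (Suc n)) q' \<le> s" "(norm (f q))\<^sup>2 \<le> M * norm (f q')"
    using three_circles_geometric_mean[of f "x (Suc n)" 3 s M q] s by auto
  have "(M * exp (- (2 ^ n * b)))\<^sup>2 \<le> (norm (f q))\<^sup>2" using q(2) M by (intro power_mono) auto
  also note q'(2)
  also have "(M * exp (- (2 ^ n * b)))\<^sup>2 = M * (M * exp (- (2 ^ Suc n * b)))"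
    by (simp add: power_mult_distrib power2_eq_square flip: exp_add)
  finally have "M * exp (- (2 ^ Suc n * b)) \<le> norm (f q')" using M by simp
  with q'(1) show ?case by blast
qed

text \<open>Follow the path and stop whenever the distance from the last stop is exactly \<open>s\<close>.  Every full step uses up
  at least \<open>s\<close> of the length, which bounds the number of steps, and the longest such sequence ends within \<open>s\<close> of
  the end of the path.\<close>

lemma path_equal_steps:
  fixes g :: "real \<Rightarrow> 'a::metric_space"
  assumes g: "path g" and s: "0 < s" and len: "curve_length g < ereal L"
  obtains n and x :: "nat \<Rightarrow> 'a" where "x 0 = pathstart g" "x n = pathfinish g"
    "\<And>i. x i \<in> path_image g" "\<And>i. i < n \<Longrightarrow> dist (x i) (x (Suc i)) \<le> s" "real n \<le> L / s + 1"
proof -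
  define Q where "Q k \<longleftrightarrow> (\<exists>t::nat \<Rightarrow> real. mono t \<and> range t \<subseteq> {0..1} \<and> t 0 = 0 \<and>
      (\<forall>i<k. dist (g (t i)) (g (t (Suc i))) = s))" for k
  have Q0: "Q 0" unfolding Q_def by (intro exI[of _ "\<lambda>_. 0"]) (auto simp: mono_def)
  have Qle: "real k \<le> L / s" if k: "Q k" for k
  proof -
    obtain t :: "nat \<Rightarrow> real" where t: "mono t \<and> range t \<subseteq> {0..1} \<and> t 0 = 0 \<and>
        (\<forall>i<k. dist (g (t i)) (g (t (Suc i))) = s)"
      using k unfolding Q_def by (elim exE)
    have "ereal (\<Sum>i<k. dist (g (t i)) (g (t (Suc i)))) \<le> curve_length g"
      unfolding total_variation_def by (rule SUP_upper2[of "(k, t)"]) (use t in auto)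
    also have "(\<Sum>i<k. dist (g (t i)) (g (t (Suc i)))) = real k * s" using t by simp
    finally have "ereal (real k * s) < ereal L" using len by (rule le_less_trans)
    thus ?thesis using s by (simp add: field_simps)
  qed
  have Qbd: "j \<le> nat \<lfloor>L / s\<rfloor>" if "Q j" for j using Qle[OF that] by (rule le_nat_floor)
  have Qk: "Q (Greatest Q)" using Q0 Qbd by (rule GreatestI_nat)
  have Qmax: "j \<le> Greatest Q" if "Q j" for j using that Qbd by (rule Greatest_le_nat)
  define k where "k = Greatest Q"
  obtain t :: "nat \<Rightarrow> real" where "mono t \<and> range t \<subseteq> {0..1} \<and> t 0 = 0 \<and>
      (\<forall>i<k. dist (g (t i)) (g (t (Suc i))) = s)"
    using Qk unfolding Q_def k_def by (elim exE)
  hence t: "mono t" "range t \<subseteq> {0..1}" "t 0 = 0"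
      "\<And>i. i < k \<Longrightarrow> dist (g (t i)) (g (t (Suc i))) = s" by auto
  have t01: "0 \<le> t i" "t i \<le> 1" for i using t(2) by (auto simp: image_subset_iff)
  have last: "dist (g (t k)) (g 1) \<le> s"
  proof (rule ccontr)
    assume far: "\<not> dist (g (t k)) (g 1) \<le> s"
    have "continuous_on {t k..1} (\<lambda>u. dist (g (t k)) (g u))"
      using g t01[of k] unfolding path_def by (intro continuous_intros) (auto intro: continuous_on_subset)
    then obtain u where u: "t k \<le> u" "u \<le> 1" "dist (g (t k)) (g u) = s"
      using IVT'[of "\<lambda>u. dist (g (t k)) (g u)" "t k" s 1] far s t01[of k] by auto
    define t' where "t' i = (if i \<le> k then t i else u)" for i
    have "mono t'"
    proof (rule monoI)
      fix i j :: nat assume ij: "i \<le> j"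
      have "t i \<le> t k" if "i \<le> k" using t(1) that by (rule monoD)
      thus "t' i \<le> t' j" using ij u(1) monoD[OF t(1) ij] by (auto simp: t'_def)
    qed
    moreover have "range t' \<subseteq> {0..1}" using t01 u order_trans[OF t01(1) u(1)] by (auto simp: t'_def)
    moreover have "dist (g (t' i)) (g (t' (Suc i))) = s" if "i < Suc k" for i
      using that t(4) u(3) by (auto simp: t'_def less_Suc_eq)
    ultimately have "Q (Suc k)" unfolding Q_def using t(3) by (intro exI[of _ t']) (auto simp: t'_def)
    from Qmax[OF this] show False by (simp add: k_def)
  qed
  define x where "x i = (if i \<le> k then g (t i) else g 1)" for i
  show ?thesis
  proof (rule that[of x "Suc k"])
    show "x 0 = pathstart g" "x (Suc k) = pathfinish g"
      using t(3) by (auto simp: x_def pathstart_def pathfinish_def)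
    show "x i \<in> path_image g" for i using t01 by (auto simp: x_def path_image_def)
    show "dist (x i) (x (Suc i)) \<le> s" if "i < Suc k" for i
      using that t(4) last by (auto simp: x_def less_Suc_eq)
    show "real (Suc k) \<le> L / s + 1" using Qle[OF Qk] by (simp add: k_def)
  qed
qed

text \<open>The chain has radius \<open>s = \<epsilon>/5\<close> and steps \<open>2 s\<close>, so the discs of radius \<open>9 s\<close> that it needs
  lie within distance \<open>2 \<epsilon>\<close> of \<open>V\<close>.  The path may exceed \<open>D\<close> by one step, and the
  last step may be short; these two additional steps give the factor 4.\<close>

lemma uniform_lower_bound_from_one_point:
  fixes f :: "complex \<Rightarrow> complex"
  assumes holf: "f holomorphic_on W" and bd: "\<And>w. w \<in> W \<Longrightarrow> norm (f w) \<le> M" and M: "0 < M"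
    and \<epsilon>: "0 < \<epsilon>" and W: "\<And>z. z \<in> V \<Longrightarrow> ball z (2 * \<epsilon>) \<subseteq> W"
    and diam: "intrinsic_diam V \<le> ereal D" and p: "p \<in> V" "M * exp (- b) \<le> norm (f p)" and b: "0 \<le> b"
    and z: "z \<in> V"
  shows "\<exists>q. dist z q \<le> \<epsilon> / 5 \<and> M * exp (- (4 * 2 powr (5 / 2 * (D / \<epsilon>)) * b)) \<le> norm (f q)"
proof -
  have "intrinsic_dist V p z \<le> ereal D"
    using diam p(1) z unfolding intrinsic_diam_def SUP_le_iff by blast
  also have "ereal D < ereal (D + 2 * \<epsilon> / 5)" using \<epsilon> by simp
  finally obtain g where "g \<in> {g. path g \<and> path_image g \<subseteq> V \<and> pathstart g = p \<and> pathfinish g = z}"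
      and glen: "curve_length g < ereal (D + 2 * \<epsilon> / 5)"
    unfolding intrinsic_dist_def INF_less_iff by (elim bexE)
  hence g: "path g" "path_image g \<subseteq> V" "pathstart g = p" "pathfinish g = z" by auto
  have s: "0 < 2 * (\<epsilon> / 5)" using \<epsilon> by simp
  obtain n and x :: "nat \<Rightarrow> complex" where x: "x 0 = pathstart g" "x n = pathfinish g"
    "\<And>i. x i \<in> path_image g" "\<And>i. i < n \<Longrightarrow> dist (x i) (x (Suc i)) \<le> 2 * (\<epsilon> / 5)"
    "real n \<le> (D + 2 * \<epsilon> / 5) / (2 * (\<epsilon> / 5)) + 1"
    using path_equal_steps[OF g(1) s glen] by metis
  have n: "real n \<le> 2 + 5 / 2 * (D / \<epsilon>)"
  proof -
    have "(D + 2 * \<epsilon> / 5) / (2 * (\<epsilon> / 5)) = 5 / 2 * (D / \<epsilon>) + 1" using \<epsilon> by (simp add: field_simps)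
    with x(5) show ?thesis by linarith
  qed
  have sub: "cball (x i) (9 * (\<epsilon> / 5)) \<subseteq> W" for i
  proof -
    have "cball (x i) (9 * (\<epsilon> / 5)) \<subseteq> ball (x i) (2 * \<epsilon>)" using \<epsilon> by auto
    also have "\<dots> \<subseteq> W" using x(3)[of i] g(2) by (intro W) auto
    finally show ?thesis .
  qed
  have ends: "x 0 = p" "x n = z" using x(1,2) g(3,4) by simp_all
  have "\<exists>q. dist (x n) q \<le> \<epsilon> / 5 \<and> M * exp (- (2 ^ n * b)) \<le> norm (f q)"
    using \<epsilon> p(2) by (intro lower_bound_propagates_along_chain[where W = W and x = x and p = p and s = "\<epsilon> / 5"] holf bd M sub x(4)) (auto simp: ends)
  then obtain q where q: "dist z q \<le> \<epsilon> / 5" "M * exp (- (2 ^ n * b)) \<le> norm (f q)"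
    unfolding ends by (elim exE conjE)
  have "2 ^ n = 2 powr real n" by (simp add: powr_realpow)
  also have "\<dots> \<le> 2 powr (2 + 5 / 2 * (D / \<epsilon>))" using n by (intro powr_mono) auto
  also have "\<dots> = 4 * 2 powr (5 / 2 * (D / \<epsilon>))" by (simp add: powr_add)
  finally have "2 ^ n * b \<le> 4 * 2 powr (5 / 2 * (D / \<epsilon>)) * b" using b by (rule mult_right_mono)
  hence "M * exp (- (4 * 2 powr (5 / 2 * (D / \<epsilon>)) * b)) \<le> M * exp (- (2 ^ n * b))" using M by simp
  with q show ?thesis by (meson order_trans)
qed

section \<open>Counting points with a grid\<close>

lemma card_floor_image_le:
  fixes X :: "real set"
  assumes fin: "finite X" and L: "0 \<le> L" and diam: "\<And>x y. x \<in> X \<Longrightarrow> y \<in> X \<Longrightarrow> x - y \<le> L"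
  shows "real (card (floor ` X)) \<le> L + 2"
proof (cases "X = {}")
  case False
  define m where "m = Min X"
  have m: "m \<in> X" "\<And>x. x \<in> X \<Longrightarrow> m \<le> x" using fin False by (auto simp: m_def)
  have "floor ` X \<subseteq> {\<lfloor>m\<rfloor>..\<lfloor>m\<rfloor> + \<lceil>L\<rceil>}"
  proof clarify
    fix x assume x: "x \<in> X"
    have "m \<le> x" "x \<le> m + L" using m(2)[OF x] diam[OF x m(1)] by auto
    hence "\<lfloor>m\<rfloor> \<le> \<lfloor>x\<rfloor>" "\<lfloor>x\<rfloor> \<le> \<lfloor>m\<rfloor> + \<lceil>L\<rceil>" by linarith+
    thus "\<lfloor>x\<rfloor> \<in> {\<lfloor>m\<rfloor>..\<lfloor>m\<rfloor> + \<lceil>L\<rceil>}" by simp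
  qed
  hence "card (floor ` X) \<le> card {\<lfloor>m\<rfloor>..\<lfloor>m\<rfloor> + \<lceil>L\<rceil>}" by (intro card_mono) auto
  also have "\<dots> = nat (\<lceil>L\<rceil> + 1)" by simp
  finally have "real (card (floor ` X)) \<le> real (nat (\<lceil>L\<rceil> + 1))" by simp
  also have "\<dots> = real_of_int (\<lceil>L\<rceil> + 1)" using L by simp
  also have "\<dots> \<le> L + 2" by linarith
  finally show ?thesis .
qed (use L in simp)

text \<open>A grid cell has diameter \<open>\<surd>2 \<delta>\<close>, hence lies in a disc of radius \<open>3/2 \<delta>\<close> about any of its points.\<close>

lemma sum_le_by_grid:
  fixes A :: "complex set" and n :: "complex \<Rightarrow> real"
  assumes A: "finite A" and \<delta>: "0 < \<delta>" and L: "0 \<le> L" and C: "0 \<le> C"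
    and diam: "\<And>a b. a \<in> A \<Longrightarrow> b \<in> A \<Longrightarrow> dist a b \<le> L"
    and n: "\<And>a. a \<in> A \<Longrightarrow> 0 \<le> n a"
    and loc: "\<And>a. a \<in> A \<Longrightarrow> (\<Sum>b\<in>A \<inter> cball a (3/2 * \<delta>). n b) \<le> C"
  shows "(\<Sum>a\<in>A. n a) \<le> (L / \<delta> + 2)\<^sup>2 * C"
proof -
  define \<kappa> where "\<kappa> a = (\<lfloor>Re a / \<delta>\<rfloor>, \<lfloor>Im a / \<delta>\<rfloor>)" for a
  have "\<bar>Re a - Re b\<bar> \<le> L" "\<bar>Im a - Im b\<bar> \<le> L" if "a \<in> A" "b \<in> A" for a b
    using diam[OF that] abs_Re_le_cmod[of "a - b"] abs_Im_le_cmod[of "a - b"] by (auto simp: dist_norm)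
  hence d: "Re a / \<delta> - Re b / \<delta> \<le> L / \<delta>" "Im a / \<delta> - Im b / \<delta> \<le> L / \<delta>" if "a \<in> A" "b \<in> A" for a b
    using that \<delta> by (auto simp: diff_divide_distrib[symmetric] abs_le_iff intro!: divide_right_mono)
  have cR: "real (card (floor ` (\<lambda>a. Re a / \<delta>) ` A)) \<le> L / \<delta> + 2"
    using A L \<delta> d(1) by (intro card_floor_image_le) auto
  have cI: "real (card (floor ` (\<lambda>a. Im a / \<delta>) ` A)) \<le> L / \<delta> + 2"
    using A L \<delta> d(2) by (intro card_floor_image_le) auto
  have "card (\<kappa> ` A) \<le> card ((floor ` (\<lambda>a. Re a / \<delta>) ` A) \<times> (floor ` (\<lambda>a. Im a / \<delta>) ` A))"
    using A by (intro card_mono) (auto simp: \<kappa>_def)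
  hence "real (card (\<kappa> ` A)) \<le> real (card (floor ` (\<lambda>a. Re a / \<delta>) ` A)) * real (card (floor ` (\<lambda>a. Im a / \<delta>) ` A))"
    unfolding card_cartesian_product of_nat_mult[symmetric] of_nat_le_iff .
  also have "\<dots> \<le> (L / \<delta> + 2) * (L / \<delta> + 2)" using cR cI L \<delta> by (intro mult_mono) auto
  finally have card: "real (card (\<kappa> ` A)) \<le> (L / \<delta> + 2)\<^sup>2" by (simp add: power2_eq_square)
  have "(\<Sum>a\<in>A. n a) = (\<Sum>c\<in>\<kappa> ` A. \<Sum>a\<in>{a\<in>A. \<kappa> a = c}. n a)" using A by (rule sum.image_gen)
  also have "\<dots> \<le> (\<Sum>c\<in>\<kappa> ` A. C)"
  proof (rule sum_mono)
    fix c assume "c \<in> \<kappa> ` A"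
    then obtain a where a: "a \<in> A" "c = \<kappa> a" by auto
    have "{b\<in>A. \<kappa> b = c} \<subseteq> A \<inter> cball a (3/2 * \<delta>)"
    proof
      fix b assume "b \<in> {b\<in>A. \<kappa> b = c}"
      hence b: "b \<in> A" "\<kappa> b = c" by auto
      have fl: "\<bar>x - y\<bar> \<le> \<delta>" if "\<lfloor>x / \<delta>\<rfloor> = \<lfloor>y / \<delta>\<rfloor>" for x y
      proof -
        have "\<bar>x / \<delta> - y / \<delta>\<bar> \<le> 1" using that by linarith
        thus ?thesis using \<delta> by (simp add: diff_divide_distrib[symmetric] abs_divide)
      qed
      have "\<bar>Re (a - b)\<bar> \<le> \<delta>" "\<bar>Im (a - b)\<bar> \<le> \<delta>"
        using a(2) b(2) by (auto simp: \<kappa>_def intro!: fl)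
      hence "(Re (a - b))\<^sup>2 \<le> \<delta>\<^sup>2" "(Im (a - b))\<^sup>2 \<le> \<delta>\<^sup>2"
        using \<delta> by (auto intro!: power2_le_iff_abs_le[THEN iffD2])
      hence "(norm (a - b))\<^sup>2 \<le> 2 * \<delta>\<^sup>2" by (simp add: cmod_power2)
      also have "\<dots> \<le> (3/2 * \<delta>)\<^sup>2" unfolding power_mult_distrib by (simp add: power2_eq_square)
      finally have "norm (a - b) \<le> 3/2 * \<delta>" by (rule power2_le_imp_le) (use \<delta> in simp)
      thus "b \<in> A \<inter> cball a (3/2 * \<delta>)" using b(1) by (simp add: dist_norm)
    qed
    hence "(\<Sum>a\<in>{a\<in>A. \<kappa> a = c}. n a) \<le> (\<Sum>b\<in>A \<inter> cball a (3/2 * \<delta>). n b)"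
      using A n by (intro sum_mono2) auto
    with loc[OF a(1)] show "(\<Sum>a\<in>{a\<in>A. \<kappa> a = c}. n a) \<le> C" by linarith
  qed
  also have "\<dots> = real (card (\<kappa> ` A)) * C" by simp
  also have "\<dots> \<le> (L / \<delta> + 2)\<^sup>2 * C" using card C by (rule mult_right_mono)
  finally show ?thesis .
qed

section \<open>The bound for the variation of the argument\<close>

lemma dist_le_intrinsic_diam:
  assumes "intrinsic_diam V \<le> ereal D" "x \<in> V" "y \<in> V"
  shows "dist x y \<le> D"
proof -
  have "ereal (dist x y) \<le> intrinsic_dist V x y"
    unfolding intrinsic_dist_def
  proof (rule INF_greatest)
    fix g assume "g \<in> {g. path g \<and> path_image g \<subseteq> V \<and> pathstart g = x \<and> pathfinish g = y}"
    hence g: "g 0 = x" "g 1 = y" by (auto simp: pathstart_def pathfinish_def)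
    have "polygon_reaches g 1 (dist (g 0) (g 1))"
      using polygon_reaches_0 by (rule polygon_reaches_extend) auto
    thus "ereal (dist x y) \<le> curve_length g"
      using polygon_reaches_le_total_variation g by metis
  qed
  also have "\<dots> \<le> intrinsic_diam V"
    unfolding intrinsic_diam_def using assms(2,3) by (meson SUP_upper SUP_upper2 order_refl)
  finally show ?thesis using assms(1) by (meson ereal_less_eq(3) order_trans)
qed

lemma ball_subset_of_frontier_gap:
  fixes x :: "'a::euclidean_space"
  assumes x: "x \<in> A" "A \<subseteq> S" and gap: "setdist A (frontier S) \<ge> \<epsilon>"
  shows "ball x \<epsilon> \<subseteq> S"
proof (cases "0 < \<epsilon>")
  case True
  show ?thesis
  proof (rule ccontr)
    assume "\<not> ball x \<epsilon> \<subseteq> S"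
    moreover have "x \<in> ball x \<epsilon> \<inter> S" using x True by auto
    ultimately have "ball x \<epsilon> \<inter> frontier S \<noteq> {}"
      by (intro connected_Int_frontier connected_ball) blast+
    then obtain y where y: "dist x y < \<epsilon>" "y \<in> frontier S" by auto
    have "setdist A (frontier S) \<le> dist x y" using x(1) y(2) by (rule setdist_le_dist)
    with gap y(1) show False by linarith
  qed
next
  case False
  thus ?thesis by (simp add: ball_empty)
qed

text \<open>With \<open>x = 3 + h\<close> both follow from \<open>e\<^sup>9 \<ge> 7000\<close> and \<open>e\<^bsup>3h\<^esup> \<ge> 1 + 3 h + 9 h\<^sup>2/2\<close>, since \<open>24 \<cdot> 17\<^sup>2 < 7000\<close>.\<close>

lemma grid_factor_le_exp:
  fixes x :: real
  assumes "3 \<le> x" shows "24 * (5 * x + 2)\<^sup>2 \<le> exp (3 * x)" "320 \<le> exp (3 * x)"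
proof -
  define h where "h = x - 3"
  have h: "0 \<le> h" "x = 3 + h" using assms by (auto simp: h_def)
  \<comment> \<open>\<open>145/128 = 1 + h + h\<^sup>2/2\<close> for \<open>h = 1/8\<close>\<close>
  have "27 / 10 \<le> (145 / 128 :: real) ^ 8" by (simp add: power_divide)
  also have "\<dots> \<le> exp (1/8) ^ 8"
    using exp_lower_Taylor_quadratic[of "1/8::real"] by (intro power_mono) (auto simp: power2_eq_square)
  also have "\<dots> = exp 1" by (simp flip: exp_of_nat_mult)
  finally have "(27 / 10) ^ 9 \<le> exp (1::real) ^ 9" by (intro power_mono) auto
  also have "\<dots> = exp 9" by (simp flip: exp_of_nat_mult)
  finally have e9: "7000 \<le> exp (9::real)" by (simp add: power_divide)
  have eq: "exp (3 * x) = exp 9 * exp (3 * h)" unfolding h(2) by (simp flip: exp_add)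
  have "1 + 3 * h + (3 * h)\<^sup>2 / 2 \<le> exp (3 * h)" using h by (intro exp_lower_Taylor_quadratic) auto
  hence e: "7000 * (1 + 3 * h + (3 * h)\<^sup>2 / 2) \<le> exp (3 * x)"
    unfolding eq using e9 h(1) by (intro mult_mono) auto
  have "24 * (5 * x + 2)\<^sup>2 = 24 * (289 + 170 * h + 25 * h\<^sup>2)"
    unfolding h(2) by (simp add: power2_eq_square algebra_simps)
  also have "\<dots> \<le> 7000 * (1 + 3 * h + (3 * h)\<^sup>2 / 2)" using h(1) by (simp add: power_mult_distrib)
  also note e
  finally show "24 * (5 * x + 2)\<^sup>2 \<le> exp (3 * x)" .
  have "7000 * 1 \<le> 7000 * (1 + 3 * h + (3 * h)\<^sup>2 / 2)" using h(1) by (intro mult_left_mono) auto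
  with e show "320 \<le> exp (3 * x)" by linarith
qed

lemma two_powr_le_exp:
  fixes x :: real assumes "0 \<le> x" shows "2 powr (5 / 2 * x) \<le> exp (2 * x)"
proof -
  have "5 / 2 * x * ln 2 \<le> 5 / 2 * x * (4 / 5)"
    using assms ln2_le_25_over_36 by (intro mult_left_mono) auto
  thus ?thesis by (simp add: powr_def mult_ac)
qed

text \<open>Here \<open>N\<close> is the number of zeros, \<open>\<kappa>\<close> the total curvature and \<open>l = \<bar>\<Gamma>\<bar>/\<epsilon>\<close>.  The hypotheses yield
  \<open>4 N \<le> b e\<^sup>5\<^sup>x\<close> and \<open>80 \<Lambda> \<le> b e\<^sup>5\<^sup>x\<close>, through \<open>ln 2 \<ge> 2/3\<close> and the two numerical lemmas above; the first
  covers \<open>\<pi> N\<close>.\<close>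

lemma argument_increment_constants:
  fixes x b \<Lambda> N \<kappa> l :: real
  assumes x: "3 \<le> x" and b: "0 \<le> b" and \<Lambda>: "\<Lambda> = 4 * 2 powr (5 / 2 * x) * b"
    and N: "0 \<le> N" "N * ln 2 \<le> (5 * x + 2)\<^sup>2 * \<Lambda>" and \<kappa>: "0 \<le> \<kappa>" and l: "0 \<le> l"
  shows "N * (\<kappa> + pi) + 80 * \<Lambda> * l \<le> b * (l + \<kappa> + 1) * exp (5 * x)"
proof -
  define P where "P = b * exp (5 * x)"
  have P: "P = b * (exp (3 * x) * exp (2 * x))" unfolding P_def by (simp flip: exp_add)
  have \<Lambda>le: "\<Lambda> \<le> 4 * exp (2 * x) * b"
    unfolding \<Lambda> using x b two_powr_le_exp[of x] by (intro mult_right_mono mult_left_mono) auto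
  have "N * (2 / 3) \<le> N * ln 2" using N(1) ln2_ge_two_thirds by (rule mult_left_mono[rotated])
  also note N(2)
  also have "(5 * x + 2)\<^sup>2 * \<Lambda> \<le> (5 * x + 2)\<^sup>2 * (4 * exp (2 * x) * b)"
    using \<Lambda>le by (rule mult_left_mono) simp
  finally have "4 * N \<le> (24 * (5 * x + 2)\<^sup>2) * (exp (2 * x) * b)" by simp
  also have "\<dots> \<le> exp (3 * x) * (exp (2 * x) * b)"
    using grid_factor_le_exp(1)[OF x] b by (intro mult_right_mono) auto
  also have "\<dots> = P" unfolding P by simp
  finally have N4: "4 * N \<le> P" .
  have "80 * \<Lambda> \<le> 320 * (exp (2 * x) * b)" using \<Lambda>le by (simp add: mult_ac)
  also have "\<dots> \<le> exp (3 * x) * (exp (2 * x) * b)"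
    using grid_factor_le_exp(2)[OF x] b by (intro mult_right_mono) auto
  also have "\<dots> = P" unfolding P by simp
  finally have "80 * \<Lambda> * l \<le> P * l" using l by (rule mult_right_mono)
  moreover have "N * \<kappa> \<le> P * \<kappa>" using N4 N(1) \<kappa> by (intro mult_right_mono) auto
  moreover have "N * pi \<le> N * 4" using N(1) pi_less_4 by (intro mult_left_mono) auto
  ultimately have "N * (\<kappa> + pi) + 80 * \<Lambda> * l \<le> P * (l + \<kappa> + 1)" using N4 by (simp add: distrib_left)
  thus ?thesis unfolding P_def by (simp add: mult_ac)
qed

text \<open>The zeros that matter are those within \<open>4 \<epsilon>/5\<close> of the curve; they are divided out globally, once.  For a
  point \<open>z\<close> of the curve and the nearby point \<open>q\<close>, only those within \<open>\<epsilon>/2\<close> of \<open>q\<close> enter the principal part of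
  \<open>f'/f\<close>; replacing them by all zeros afterwards only increases the bound.\<close>

lemma arg_variation_bound:
  fixes U U'' :: "complex set" and f :: "complex \<Rightarrow> complex"
  assumes U: "open U" "connected U" and holf: "f holomorphic_on U"
    and bd: "\<And>w. w \<in> U \<Longrightarrow> norm (f w) \<le> M" and M: "0 < M" and \<epsilon>: "0 < \<epsilon>" and D: "3 \<le> D / \<epsilon>"
    and U'': "\<And>z. z \<in> U'' \<Longrightarrow> ball z (2 * \<epsilon>) \<subseteq> U"
    and \<gamma>: "piecewise_smooth \<gamma>" "\<And>z. z \<in> path_image \<gamma> \<Longrightarrow> ball z \<epsilon> \<subseteq> U''"
    and nz: "\<And>z. z \<in> path_image \<gamma> \<Longrightarrow> f z \<noteq> 0"
    and diam: "intrinsic_diam U'' \<le> ereal D"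
    and p: "p \<in> U''" "M * exp (- b) \<le> norm (f p)" and b: "0 < b"
  shows "arg_variation f \<gamma> \<le> ereal (b * (integral {0..1} (\<lambda>t. norm (velocity \<gamma> t)) / \<epsilon> + total_curvature \<gamma> + 1)
           * exp (5 * (D / \<epsilon>)))"
proof -
  define \<Gamma> where "\<Gamma> = path_image \<gamma>"
  have path: "path \<gamma>" using \<gamma>(1) by (simp add: piecewise_smooth_def)
  have \<Gamma>U'': "\<Gamma> \<subseteq> U''" using \<gamma>(2) \<epsilon> unfolding \<Gamma>_def by (meson centre_in_ball subsetD subsetI)
  have U''U: "U'' \<subseteq> U" using U'' \<epsilon> by (meson centre_in_ball subsetD subsetI zero_less_mult_iff zero_less_numeral)
  define K where "K = {x + y |x y. x \<in> \<Gamma> \<and> y \<in> cball 0 (4 / 5 * \<epsilon>)}"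
  have memK: "w \<in> K" if "z \<in> \<Gamma>" "dist z w \<le> 4 / 5 * \<epsilon>" for z w
    unfolding K_def mem_Collect_eq using that
    by (intro exI[of _ z] exI[of _ "w - z"]) (auto simp: dist_norm norm_minus_commute)
  have KU'': "K \<subseteq> U''"
  proof
    fix w assume "w \<in> K"
    then obtain z y where zy: "w = z + y" "z \<in> \<Gamma>" "norm y \<le> 4 / 5 * \<epsilon>" by (auto simp: K_def)
    hence "w \<in> ball z \<epsilon>" using \<epsilon> by (simp add: dist_norm)
    thus "w \<in> U''" using \<gamma>(2) zy(2) unfolding \<Gamma>_def by blast
  qed
  have "compact K" unfolding K_def \<Gamma>_def using path by (intro compact_sums) auto
  define A where "A = {z \<in> K. f z = 0}"
  have finA: "finite A"
  proof (cases "f constant_on U")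
    case True
    have "\<gamma> 0 \<in> \<Gamma>" by (simp add: \<Gamma>_def path_image_def)
    hence "f z \<noteq> 0" if "z \<in> U" for z
      using that True nz \<Gamma>U'' U''U unfolding constant_on_def \<Gamma>_def by (metis subsetD)
    hence "A = {}" using KU'' U''U by (auto simp: A_def)
    thus ?thesis by simp
  next
    case False
    thus ?thesis unfolding A_def using KU'' U''U U holf \<open>compact K\<close>
      by (intro holomorphic_compact_finite_zeros) auto
  qed
  have AU'': "A \<subseteq> U''" using KU'' by (auto simp: A_def)
  have "\<gamma> 0 \<in> \<Gamma>" by (simp add: \<Gamma>_def path_image_def)
  hence "\<exists>w\<in>U. f w \<noteq> 0" using nz \<Gamma>U'' U''U unfolding \<Gamma>_def by blast
  then obtain n :: "complex \<Rightarrow> nat" and g where g: "g holomorphic_on U" "\<And>a. a \<in> A \<Longrightarrow> g a \<noteq> 0"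
      "\<And>z. z \<in> U \<Longrightarrow> f z = (\<Prod>a\<in>A. (z - a) ^ n a) * g z"
    using holomorphic_factor_out_finite[OF holf U _ finA] AU'' U''U by blast
  define \<Lambda> where "\<Lambda> = 4 * 2 powr (5 / 2 * (D / \<epsilon>)) * b"
  have \<Lambda>: "0 < \<Lambda>" using b by (simp add: \<Lambda>_def)
  have centre: "\<exists>q. dist z q \<le> \<epsilon> / 5 \<and> M * exp (- \<Lambda>) \<le> norm (f q)" if "z \<in> U''" for z
    unfolding \<Lambda>_def using uniform_lower_bound_from_one_point[OF holf bd M \<epsilon> U'' diam p _ that] b by simp
  define near where "near q = A \<inter> cball q (\<epsilon> / 2)" for q
  define G where "G q w = (\<Prod>a\<in>A - near q. (w - a) ^ n a) * g w" for q w
  have G_hol: "G q holomorphic_on U" for q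
    unfolding G_def by (intro holomorphic_intros g(1))
  have f_eq: "f w = (\<Prod>a\<in>near q. (w - a) ^ n a) * G q w" if "w \<in> U" for q w
  proof -
    have "(\<Prod>a\<in>A. (w - a) ^ n a) = (\<Prod>a\<in>A - near q. (w - a) ^ n a) * (\<Prod>a\<in>near q. (w - a) ^ n a)"
      using finA by (intro prod.subset_diff) (auto simp: near_def)
    thus ?thesis using g(3)[OF that] by (simp add: G_def mult_ac)
  qed
  have local: "real (\<Sum>a\<in>near q. n a) * ln 2 \<le> \<Lambda> \<and>
      (\<exists>S. (\<forall>w\<in>cball q (3 * (\<epsilon> / 2)). norm (G q w) \<le> S) \<and> S * exp (- \<Lambda>) \<le> norm (G q q))"
    if z: "z \<in> U''" and q: "dist z q \<le> \<epsilon> / 5" "M * exp (- \<Lambda>) \<le> norm (f q)" for z q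
  proof -
    have "cball q (3 * (\<epsilon> / 2)) \<subseteq> ball z (2 * \<epsilon>)"
    proof
      fix w assume w: "w \<in> cball q (3 * (\<epsilon> / 2))"
      have "dist z w \<le> dist z q + dist q w" by (rule dist_triangle)
      thus "w \<in> ball z (2 * \<epsilon>)" using w q(1) \<epsilon> by simp
    qed
    hence sub: "cball q (3 * (\<epsilon> / 2)) \<subseteq> U" using U''[OF z] by blast
    have eq: "f w = (\<Prod>a\<in>near q. (w - a) ^ n a) * G q w" and le: "norm (f w) \<le> M"
      if "w \<in> cball q (3 * (\<epsilon> / 2))" for w
      using that sub by (auto intro!: f_eq bd)
    have fin: "finite (near q)" "near q \<subseteq> cball q (\<epsilon> / 2)" using finA by (auto simp: near_def)
    have pos: "0 < \<epsilon> / 2" using \<epsilon> by simp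
    show ?thesis
      using zeros_local_bound[OF holomorphic_on_subset[OF G_hol sub] fin eq le q(2) M pos] by blast
  qed
  have count: "real (\<Sum>a\<in>A. n a) * ln 2 \<le> (5 * (D / \<epsilon>) + 2)\<^sup>2 * \<Lambda>"
  proof -
    have "(\<Sum>a\<in>A. real (n a) * ln 2) \<le> (D / (\<epsilon> / 5) + 2)\<^sup>2 * \<Lambda>"
    proof (rule sum_le_by_grid[OF finA])
      fix a assume a: "a \<in> A"
      then obtain q where q: "dist a q \<le> \<epsilon> / 5" "M * exp (- \<Lambda>) \<le> norm (f q)"
        using centre AU'' by blast
      \<comment> \<open>\<open>3/2 \<cdot> \<epsilon>/5 + \<epsilon>/5 = \<epsilon>/2\<close>\<close>
      have "A \<inter> cball a (3 / 2 * (\<epsilon> / 5)) \<subseteq> near q"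
      proof
        fix c assume c: "c \<in> A \<inter> cball a (3 / 2 * (\<epsilon> / 5))"
        have "dist q c \<le> dist a q + dist a c" by (metis dist_commute dist_triangle)
        thus "c \<in> near q" using c q(1) by (auto simp: near_def)
      qed
      hence "(\<Sum>c\<in>A \<inter> cball a (3 / 2 * (\<epsilon> / 5)). real (n c) * ln 2) \<le> (\<Sum>c\<in>near q. real (n c) * ln 2)"
        using finA by (intro sum_mono2) (auto simp: near_def)
      also have "\<dots> \<le> \<Lambda>" using local[OF _ q] a AU'' by (auto simp: sum_distrib_right)
      finally show "(\<Sum>c\<in>A \<inter> cball a (3 / 2 * (\<epsilon> / 5)). real (n c) * ln 2) \<le> \<Lambda>" .
    next
      show "dist a c \<le> D" if "a \<in> A" "c \<in> A" for a c
        using that AU'' by (intro dist_le_intrinsic_diam[OF diam]) auto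
      show "0 \<le> D" using dist_le_intrinsic_diam[OF diam p(1) p(1)] by simp
    qed (use \<epsilon> \<Lambda> in auto)
    moreover have "D / (\<epsilon> / 5) = 5 * (D / \<epsilon>)" by simp
    ultimately show ?thesis unfolding of_nat_sum sum_distrib_right by (simp only:)
  qed
  define h where "h t = (\<Sum>a\<in>A. real (n a) * \<bar>Im (velocity \<gamma> t / (\<gamma> t - a))\<bar>) + 80 * \<Lambda> / \<epsilon> * norm (velocity \<gamma> t)" for t
  obtain T where T: "finite T" "\<And>s. s \<in> {0..1} - T \<Longrightarrow> (\<gamma> has_vector_derivative velocity \<gamma> s) (at s)"
    "(\<lambda>s. norm (velocity \<gamma> s)) integrable_on {0..1}" "valid_path \<gamma>"
    using piecewise_smooth_velocity[OF \<gamma>(1)] by blast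
  have A\<Gamma>: "a \<notin> path_image \<gamma>" if "a \<in> A" for a using that nz by (auto simp: A_def)
  have bound: "\<bar>Im (velocity \<gamma> t * (deriv f (\<gamma> t) / f (\<gamma> t)))\<bar> \<le> h t" if t: "t \<in> {0..1}" for t
  proof -
    define z where "z = \<gamma> t"
    define v where "v = velocity \<gamma> t"
    have z: "z \<in> \<Gamma>" "z \<in> U''" using t \<Gamma>U'' by (auto simp: z_def \<Gamma>_def path_image_def)
    then obtain q where q: "dist z q \<le> \<epsilon> / 5" "M * exp (- \<Lambda>) \<le> norm (f q)" using centre by blast
    obtain S where S: "\<And>w. w \<in> cball q (3 * (\<epsilon> / 2)) \<Longrightarrow> norm (G q w) \<le> S" "S * exp (- \<Lambda>) \<le> norm (G q q)"
      using local[OF z(2) q] by blast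
    \<comment> \<open>\<open>\<epsilon>/5 + \<epsilon>/2 < 4 \<epsilon>/5\<close>: the disc about \<open>q\<close> meets no zeros other than those in \<open>A\<close>.\<close>
    have inK: "w \<in> K" if "w \<in> ball q (\<epsilon> / 2)" for w
    proof (rule memK[OF z(1)])
      have "dist z w \<le> dist z q + dist q w" by (rule dist_triangle)
      thus "dist z w \<le> 4 / 5 * \<epsilon>" using that q(1) \<epsilon> by simp
    qed
    have Gnz: "G q w \<noteq> 0" if w: "w \<in> ball q (\<epsilon> / 2)" for w
    proof
      assume "G q w = 0"
      moreover have "w \<notin> A - near q" using w by (auto simp: near_def)
      ultimately have "g w = 0" using finA by (auto simp: G_def)
      moreover from this have "f w = 0" using g(3)[of w] inK[OF w] KU'' U''U by auto
      ultimately show False using g(2)[of w] inK[OF w] by (auto simp: A_def)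
    qed
    have "ball q (\<epsilon> / 2) \<subseteq> U" using inK KU'' U''U by blast
    hence Gb: "norm (deriv (G q) z / G q z) \<le> 40 * \<Lambda> / (\<epsilon> / 2)"
      using q(1) S \<epsilon> Gnz \<Lambda> G_hol[of q]
      by (intro zero_free_logderiv_bound[of "G q" q "\<epsilon> / 2" S \<Lambda>])
         (auto intro: holomorphic_on_subset simp: dist_commute)
    have zb: "z \<in> ball q (\<epsilon> / 2)" using q(1) \<epsilon> by (simp add: dist_commute)
    have zU: "z \<in> U" using z U''U by auto
    have "deriv f z / f z = (\<Sum>a\<in>near q. of_nat (n a) / (z - a)) + deriv (G q) z / G q z"
    proof (rule logderiv_near_zeros[OF _ _ _ _ U(1) zU f_eq])
      show "(G q has_field_derivative deriv (G q) z) (at z)"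
        using G_hol U(1) zU by (rule holomorphic_derivI)
      show "z \<notin> near q" using A\<Gamma> z(1) by (auto simp: near_def \<Gamma>_def)
    qed (use finA Gnz[OF zb] in \<open>auto simp: near_def\<close>)
    hence "v * (deriv f z / f z) = (\<Sum>a\<in>near q. v * (of_nat (n a) / (z - a))) + v * (deriv (G q) z / G q z)"
      by (simp only: distrib_left sum_distrib_left)
    also have "(\<Sum>a\<in>near q. v * (of_nat (n a) / (z - a))) = (\<Sum>a\<in>near q. of_real (real (n a)) * (v / (z - a)))"
      by (rule sum.cong) simp_all
    finally have "Im (v * (deriv f z / f z)) = (\<Sum>a\<in>near q. real (n a) * Im (v / (z - a))) + Im (v * (deriv (G q) z / G q z))"
      by (simp only: plus_complex.sel Im_sum times_complex.sel Re_complex_of_real Im_complex_of_real mult_zero_left add_0_right)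
    also have "\<bar>\<dots>\<bar> \<le> (\<Sum>a\<in>near q. \<bar>real (n a) * Im (v / (z - a))\<bar>) + \<bar>Im (v * (deriv (G q) z / G q z))\<bar>"
      by (intro order_trans[OF abs_triangle_ineq] add_mono sum_abs) auto
    also have "(\<Sum>a\<in>near q. \<bar>real (n a) * Im (v / (z - a))\<bar>) \<le> (\<Sum>a\<in>A. real (n a) * \<bar>Im (v / (z - a))\<bar>)"
      unfolding abs_mult abs_of_nat using finA by (intro sum_mono2) (auto simp: near_def)
    also have "\<bar>Im (v * (deriv (G q) z / G q z))\<bar> \<le> norm v * (40 * \<Lambda> / (\<epsilon> / 2))"
      by (intro order_trans[OF abs_Im_le_cmod]) (simp only: norm_mult, intro mult_left_mono Gb norm_ge_zero)
    finally show ?thesis unfolding h_def z_def[symmetric] v_def[symmetric] by (simp add: mult_ac)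
  qed
  note rot = rotation_le_total_curvature[OF \<gamma>(1) A\<Gamma>]
  have "(h has_integral (\<Sum>a\<in>A. real (n a) * integral {0..1} (\<lambda>t. \<bar>Im (velocity \<gamma> t / (\<gamma> t - a))\<bar>))
       + 80 * \<Lambda> / \<epsilon> * integral {0..1} (\<lambda>t. norm (velocity \<gamma> t))) {0..1}"
    unfolding h_def using rot(1) T(3) finA
    by (intro has_integral_add has_integral_sum has_integral_mult_right integrable_integral) auto
  hence hi: "h integrable_on {0..1}" "integral {0..1} h = (\<Sum>a\<in>A. real (n a) * integral {0..1} (\<lambda>t. \<bar>Im (velocity \<gamma> t / (\<gamma> t - a))\<bar>))
       + 80 * \<Lambda> / \<epsilon> * integral {0..1} (\<lambda>t. norm (velocity \<gamma> t))"
    by (auto simp: integrable_on_def integral_unique)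
  define \<kappa> where "\<kappa> = total_curvature \<gamma>"
  define l where "l = integral {0..1} (\<lambda>t. norm (velocity \<gamma> t))"
  define N where "N = real (\<Sum>a\<in>A. n a)"
  have l: "0 \<le> l" unfolding l_def using T(3) by (rule integral_nonneg) simp
  have "integral {0..1} h \<le> (\<Sum>a\<in>A. real (n a) * (\<kappa> + pi)) + 80 * \<Lambda> / \<epsilon> * l"
    unfolding hi(2) \<kappa>_def l_def using rot(2) \<Lambda> \<epsilon> by (intro add_mono sum_mono mult_left_mono) auto
  also have "\<dots> = N * (\<kappa> + pi) + 80 * \<Lambda> * (l / \<epsilon>)" by (simp add: N_def sum_distrib_right)
  finally have hle: "integral {0..1} h \<le> N * (\<kappa> + pi) + 80 * \<Lambda> * (l / \<epsilon>)" .
  have "0 \<le> \<kappa>" unfolding \<kappa>_def using \<gamma>(1) by (rule total_curvature_nonneg)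
  hence "N * (\<kappa> + pi) + 80 * \<Lambda> * (l / \<epsilon>) \<le> b * (l / \<epsilon> + \<kappa> + 1) * exp (5 * (D / \<epsilon>))"
    using count b l \<epsilon> by (intro argument_increment_constants[OF D _ \<Lambda>_def]) (auto simp: N_def sum_nonneg)
  with hle have "integral {0..1} h \<le> b * (l / \<epsilon> + \<kappa> + 1) * exp (5 * (D / \<epsilon>))" by linarith
  moreover have "arg_variation f \<gamma> \<le> ereal (integral {0..1} h)"
    using T(1,2,4) U(1) \<Gamma>U'' U''U nz hi(1) bound holf
    by (intro arg_variation_le_integral[where T = T and \<gamma>' = "velocity \<gamma>" and U = U]) (auto simp: \<Gamma>_def)
  ultimately show ?thesis unfolding l_def \<kappa>_def by (meson ereal_less_eq(3) order_trans)
qed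

theorem theorem1:
  fixes U U' U'' :: "complex set" and \<gamma> :: "real \<Rightarrow> complex" and f :: "complex \<Rightarrow> complex"
    and D \<epsilon> :: real
  assumes "open U" "open U'" "open U''"
    and "path_connected U" "path_connected U'" "path_connected U''"
    and "U'' \<subseteq> U'" "U' \<subseteq> U"
    and "compact (closure U)" "simply_connected (closure U)"
    and "piecewise_smooth \<gamma>" "path_image \<gamma> \<subseteq> U''"
    and "f holomorphic_on closure U"
    and "\<forall>z\<in>path_image \<gamma>. f z \<noteq> 0"
    and "D > 0" "\<epsilon> > 0" "D / \<epsilon> > 3"
    and "setdist (path_image \<gamma>) (frontier U'') \<ge> \<epsilon>"
    and "setdist U'' (frontier U') \<ge> \<epsilon>"
    and "setdist U' (frontier U) \<ge> \<epsilon>"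
    and "intrinsic_diam U'' \<le> ereal D" "intrinsic_diam U' \<le> ereal D"
  shows "arg_variation f \<gamma> \<le>
    ereal (bernstein_index U'' U f) *
      (curve_length \<gamma> / ereal \<epsilon> + ereal (total_curvature \<gamma>) + 1) *
      ereal (exp (5 * D / \<epsilon>))"
proof -
  define M where "M = (SUP z\<in>U. norm (f z))"
  define m where "m = (SUP z\<in>U''. norm (f z))"
  define B where "B = bernstein_index U'' U f"
  have B: "B = ln (M / m)" by (simp add: B_def bernstein_index_def M_def m_def)
  have holf: "f holomorphic_on U"
    using assms(13) closure_subset by (rule holomorphic_on_subset)
  have "compact ((\<lambda>z. norm (f z)) ` closure U)"
    using assms(9,13)
    by (intro compact_continuous_image continuous_on_norm holomorphic_on_imp_continuous_on)
  hence "bdd_above ((\<lambda>z. norm (f z)) ` closure U)"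
    by (intro bounded_imp_bdd_above compact_imp_bounded)
  hence bddU: "bdd_above ((\<lambda>z. norm (f z)) ` U)"
    by (rule bdd_above_mono) (use closure_subset in blast)
  hence bddU'': "bdd_above ((\<lambda>z. norm (f z)) ` U'')"
    by (rule bdd_above_mono) (use assms(7,8) in blast)
  have bd: "norm (f w) \<le> M" if "w \<in> U" for w
    unfolding M_def using that bddU by (rule cSUP_upper)
  have z0: "\<gamma> 0 \<in> path_image \<gamma>" by (simp add: path_image_def)
  hence z0': "\<gamma> 0 \<in> U''" "f (\<gamma> 0) \<noteq> 0" using assms(12,14) by auto
  have "norm (f (\<gamma> 0)) \<le> m" unfolding m_def using z0'(1) bddU'' by (rule cSUP_upper)
  moreover have "0 < norm (f (\<gamma> 0))" using z0'(2) by simp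
  ultimately have m: "0 < m" by linarith
  have mM: "m \<le> M" unfolding m_def
    using z0'(1) assms(7,8) by (intro cSUP_least bd) auto
  have M: "0 < M" using m mM by linarith
  have B0: "0 \<le> B" unfolding B using m mM by (intro ln_ge_zero) simp
  have U'': "ball z (2 * \<epsilon>) \<subseteq> U" if z: "z \<in> U''" for z
  proof
    fix w assume w: "w \<in> ball z (2 * \<epsilon>)"
    \<comment> \<open>The midpoint lies in \<open>U'\<close> by the first gap, and then \<open>w\<close> lies in \<open>U\<close> by the second.\<close>
    define v where "v = midpoint z w"
    have "dist z v < \<epsilon>" "dist v w < \<epsilon>" using w by (auto simp: v_def dist_midpoint)
    moreover have "ball z \<epsilon> \<subseteq> U'"
      using z assms(7,19) by (rule ball_subset_of_frontier_gap)
    ultimately have "v \<in> U'" "w \<in> ball v \<epsilon>" by auto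
    moreover have "ball v \<epsilon> \<subseteq> U"
      using \<open>v \<in> U'\<close> assms(8,20) by (rule ball_subset_of_frontier_gap)
    ultimately show "w \<in> U" by blast
  qed
  have \<Gamma>: "ball z \<epsilon> \<subseteq> U''" if "z \<in> path_image \<gamma>" for z
    using that assms(12,18) by (rule ball_subset_of_frontier_gap)
  define l where "l = integral {0..1} (\<lambda>t. norm (velocity \<gamma> t))"
  define X where "X = l / \<epsilon> + total_curvature \<gamma> + 1"
  define E where "E = exp (5 * D / \<epsilon>)"
  have X0: "0 \<le> X"
  proof -
    have "0 \<le> l" unfolding l_def
      by (rule integral_nonneg) (use piecewise_smooth_velocity[OF assms(11)] in \<open>blast, simp\<close>)
    thus ?thesis using total_curvature_nonneg[OF assms(11)] assms(16) by (simp add: X_def)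
  qed
  have E0: "0 < E" by (simp add: E_def)
  have bound: "arg_variation f \<gamma> \<le> ereal (b * X * E)" if b: "B < b" for b
  proof -
    have "M / m < exp b" using b m M unfolding B by (metis divide_pos_pos exp_less_cancel_iff exp_ln)
    hence "M * exp (- b) < m" using m by (simp add: exp_minus field_simps)
    then obtain p where p: "p \<in> U''" "M * exp (- b) < norm (f p)"
      unfolding m_def using z0'(1) bddU'' by (subst (asm) less_cSUP_iff) auto
    show ?thesis unfolding X_def E_def l_def
      using arg_variation_bound[OF assms(1) path_connected_imp_connected[OF assms(4)] holf bd M assms(16) _ U''
          assms(11) \<Gamma> _ assms(21) p(1) less_imp_le[OF p(2)]] assms(14,17) B0 b by simp
  qed
  have "arg_variation f \<gamma> \<le> ereal (B * X * E)"
  proof (rule ereal_le_epsilon2)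
    fix e :: real assume e: "0 < e"
    define b where "b = B + e / (X * E + 1)"
    have pos: "0 < X * E + 1" using X0 E0 by (simp add: add_nonneg_pos)
    have "arg_variation f \<gamma> \<le> ereal (b * X * E)" using e pos by (intro bound) (simp add: b_def)
    also have "b * X * E \<le> B * X * E + e"
    proof -
      have "e * (X * E) / (X * E + 1) \<le> e" using pos e by (simp add: pos_divide_le_eq)
      thus ?thesis by (simp add: b_def distrib_right mult.assoc)
    qed
    finally show "arg_variation f \<gamma> \<le> ereal (B * X * E) + ereal e" by simp
  qed
  also have "ereal (B * X * E) = ereal B * (curve_length \<gamma> / ereal \<epsilon> + ereal (total_curvature \<gamma>) + 1) * ereal E"
    unfolding curve_length_eq_integral[OF assms(11)] l_def[symmetric] using assms(16)
    by (simp add: X_def one_ereal_def)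
  finally show ?thesis by (simp only: B_def E_def)
qed

end
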